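(* Let $k$ be a commutative ring, $G$ a groupoid with finitely many morphisms, and $A$ a left $G$-module algebra. Then the ring morphism $j:A\to\underline{\rm Hom}(Gk,A)={}^*\mathcal{C}$ is Frobenius.
   Context: $G_0$ and $G_1$ denote the sets of objects and morphisms of $G$; for $\sigma:x\to y$ in $G_1$, $s(\sigma)=x$, $t(\sigma)=y$; the composite $\sigma\tau$ is defined when $t(\tau)=s(\sigma)$; the identity morphism on $x\in G_0$ is also denoted $x$. The groupoid algebra $kG$ is the free $k$-module on $G_1$ with product of $\sigma,\tau$ equal to $\sigma\tau$ if $t(\tau)=s(\sigma)$ and $0$ otherwise, and unit $\sum_{x\in G_0}x$. A left $G$-module algebra is a unital $k$-algebra $A$ with a (unital) left $kG$-module structure such that $\sigma\cdot(ab)=(\sigma\cdot a)(\sigma\cdot b)$ for all $\sigma\in G_1$, $a,b\in A$, and such that the following equivalent conditions hold for all $\sigma\in G_1$, $a\in A$: $\sigma\cdot1_A=t(\sigma)\cdot1_A$; $a(\sigma\cdot1_A)=t(\sigma)\cdot a$; $(\sigma\cdot1_A)a=t(\sigma)\cdot a$. $Gk=(kG)^*=\bigoplus_{\sigma\in G_1}kv_\sigma$ is the dual weak Hopf algebra, $(v_\sigma)$ being the basis dual to $G_1$, with $v_\sigma v_\tau=\delta_{\sigma,\tau}v_\sigma$, $1=\sum_\sigma v_\sigma$, $\Delta(v_\sigma)=\sum_{\tau\lambda=\sigma}v_\tau\otimes v_\lambda$. $A$ is a right $Gk$-comodule algebra via $\rho(a)=a_{[0]}\otimes a_{[1]}=\sum_{\sigma\in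 G_1}\sigma\cdot a\otimes v_\sigma$. $\underline{\rm Hom}(Gk,A)=\{f\in{\rm Hom}_k(Gk,A)\mid1_{[0]}f(v_\tau1_{[1]})=f(v_\tau)\text{ for all }\tau\in G_1\}$, a ring with multiplication $(f\#g)(h)=f(h_{(2)})_{[0]}\,g(h_{(1)}f(h_{(2)})_{[1]})$ for $h\in Gk$, where $\Delta(h)=h_{(1)}\otimes h_{(2)}$. It is identified with the left dual ring ${}^*\mathcal{C}={}_A{\rm Hom}(\mathcal{C},A)$ of the $A$-coring $\mathcal{C}=\bigoplus_{\sigma\in G_1}(\sigma\cdot1_A)A\,v_\sigma\subset A\otimes Gk$. The ring morphism $j:A\to\underline{\rm Hom}(Gk,A)$ is given by $j(a)(v_x)=(x\cdot1_A)a$ for $x\in G_0$ and $j(a)(v_\sigma)=0$ if $\sigma\in G_1$ is not an identity morphism. The induced $A$-bimodule structure is $(afb)(h)=a_{[0]}f(ha_{[1]})b$. A ring morphism $A\to R$ is called Frobenius if there exist an $A$-bimodule map $\overline{\nu}:R\to A$ and an element $e=e^1\otimes_Ae^2\in R\otimes_AR$ (summation understood) such that $re^1\otimes_Ae^2=e^1\otimes_Ae^2r$ for all $r\in R$ and $\overline{\nu}(e^1)e^2=e^1\overline{\nu}(e^2)=1$. *)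

theory Defs
  imports "HOL-Algebra.Module" "HOL-Algebra.Free_Abelian_Groups"
begin

section \<open>Groupoids\<close>

record ('o, 'm) groupoid =
  Ob :: "'o set"
  Mor :: "'m set"
  src :: "'m \<Rightarrow> 'o"
  tgt :: "'m \<Rightarrow> 'o"
  ide :: "'o \<Rightarrow> 'm"
  cmp :: "'m \<Rightarrow> 'm \<Rightarrow> 'm"

text \<open>Composition is written in function order: \<open>cmp G \<sigma> \<tau>\<close> is "first \<open>\<tau>\<close>, then \<open>\<sigma>\<close>" and is only
  meaningful when \<open>tgt G \<tau> = src G \<sigma>\<close>.\<close>

locale groupoid =
  fixes G (structure)
  assumes src_closed: "\<sigma> \<in> Mor G \<Longrightarrow> src G \<sigma> \<in> Ob G"
    and tgt_closed: "\<sigma> \<in> Mor G \<Longrightarrow> tgt G \<sigma> \<in> Ob G"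
    and ide_closed: "x \<in> Ob G \<Longrightarrow> ide G x \<in> Mor G"
    and src_ide: "x \<in> Ob G \<Longrightarrow> src G (ide G x) = x"
    and tgt_ide: "x \<in> Ob G \<Longrightarrow> tgt G (ide G x) = x"
    and cmp_closed:
      "\<lbrakk>\<sigma> \<in> Mor G; \<tau> \<in> Mor G; tgt G \<tau> = src G \<sigma>\<rbrakk> \<Longrightarrow> cmp G \<sigma> \<tau> \<in> Mor G"
    and src_cmp:
      "\<lbrakk>\<sigma> \<in> Mor G; \<tau> \<in> Mor G; tgt G \<tau> = src G \<sigma>\<rbrakk> \<Longrightarrow> src G (cmp G \<sigma> \<tau>) = src G \<tau>"
    and tgt_cmp:
      "\<lbrakk>\<sigma> \<in> Mor G; \<tau> \<in> Mor G; tgt G \<tau> = src G \<sigma>\<rbrakk> \<Longrightarrow> tgt G (cmp G \<sigma> \<tau>) = tgt G \<sigma>"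
    and cmp_assoc:
      "\<lbrakk>\<rho> \<in> Mor G; \<sigma> \<in> Mor G; \<tau> \<in> Mor G; tgt G \<sigma> = src G \<rho>; tgt G \<tau> = src G \<sigma>\<rbrakk>
        \<Longrightarrow> cmp G (cmp G \<rho> \<sigma>) \<tau> = cmp G \<rho> (cmp G \<sigma> \<tau>)"
    and ide_left: "\<sigma> \<in> Mor G \<Longrightarrow> cmp G (ide G (tgt G \<sigma>)) \<sigma> = \<sigma>"
    and ide_right: "\<sigma> \<in> Mor G \<Longrightarrow> cmp G \<sigma> (ide G (src G \<sigma>)) = \<sigma>"
    and inverse_exists:
      "\<sigma> \<in> Mor G \<Longrightarrow> \<exists>\<tau> \<in> Mor G. src G \<tau> = tgt G \<sigma> \<and> tgt G \<tau> = src G \<sigma> \<and>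
         cmp G \<tau> \<sigma> = ide G (src G \<sigma>) \<and> cmp G \<sigma> \<tau> = ide G (tgt G \<sigma>)"

definition factorizations :: "('o, 'm, 'z) groupoid_scheme \<Rightarrow> 'm \<Rightarrow> ('m \<times> 'm) set" where
  "factorizations G \<sigma> =
    {(\<tau>, \<kappa>). \<tau> \<in> Mor G \<and> \<kappa> \<in> Mor G \<and> tgt G \<kappa> = src G \<tau> \<and> cmp G \<tau> \<kappa> = \<sigma>}"


section \<open>The groupoid algebra and its dual\<close>

text \<open>For a groupoid with finitely many morphisms, the free \<open>K\<close>-module on \<open>Mor G\<close> consists of all
  coefficient functions \<open>Mor G \<rightarrow> K\<close>, made extensional so that equality is equality on \<open>Mor G\<close>.  Both
  \<open>kG\<close> (coordinates with respect to the morphisms) and \<open>Gk = (kG)\<^sup>*\<close> (coordinates with respect to the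
  dual basis) are encoded on this carrier; \<open>basis K G \<sigma>\<close> is \<open>\<sigma>\<close> in the former and
  \<open>v\<^sub>\<sigma>\<close> in the latter.\<close>

definition basis :: "('k, 'x) ring_scheme \<Rightarrow> ('o, 'm, 'z) groupoid_scheme \<Rightarrow> 'm \<Rightarrow> 'm \<Rightarrow> 'k" where
  "basis K G \<sigma> = (\<lambda>\<tau>\<in>Mor G. if \<tau> = \<sigma> then \<one>\<^bsub>K\<^esub> else \<zero>\<^bsub>K\<^esub>)"

definition groupoid_algebra ::
  "('k, 'x) ring_scheme \<Rightarrow> ('o, 'm, 'z) groupoid_scheme \<Rightarrow> ('k, 'm \<Rightarrow> 'k) module" where
  "groupoid_algebra K G =
    \<lparr>carrier = Mor G \<rightarrow>\<^sub>E carrier K,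
     monoid.mult = (\<lambda>u w. \<lambda>\<sigma>\<in>Mor G. finsum K (\<lambda>(\<tau>, \<kappa>). u \<tau> \<otimes>\<^bsub>K\<^esub> w \<kappa>) (factorizations G \<sigma>)),
     one = (\<lambda>\<sigma>\<in>Mor G. if \<sigma> \<in> ide G ` Ob G then \<one>\<^bsub>K\<^esub> else \<zero>\<^bsub>K\<^esub>),
     ring.zero = (\<lambda>\<sigma>\<in>Mor G. \<zero>\<^bsub>K\<^esub>),
     ring.add = (\<lambda>u w. \<lambda>\<sigma>\<in>Mor G. u \<sigma> \<oplus>\<^bsub>K\<^esub> w \<sigma>),
     smult = (\<lambda>c u. \<lambda>\<sigma>\<in>Mor G. c \<otimes>\<^bsub>K\<^esub> u \<sigma>)\<rparr>"

text \<open>Multiplication is pointwise because \<open>v\<^sub>\<sigma> v\<^sub>\<tau> = \<delta>\<^sub>\<sigma>\<^sub>\<tau> v\<^sub>\<sigma>\<close>, and the unit is \<open>\<Sum>\<^sub>\<sigma> v\<^sub>\<sigma>\<close>.\<close>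

definition dual_groupoid_algebra ::
  "('k, 'x) ring_scheme \<Rightarrow> ('o, 'm, 'z) groupoid_scheme \<Rightarrow> ('k, 'm \<Rightarrow> 'k) module" where
  "dual_groupoid_algebra K G =
    \<lparr>carrier = Mor G \<rightarrow>\<^sub>E carrier K,
     monoid.mult = (\<lambda>h l. \<lambda>\<sigma>\<in>Mor G. h \<sigma> \<otimes>\<^bsub>K\<^esub> l \<sigma>),
     one = (\<lambda>\<sigma>\<in>Mor G. \<one>\<^bsub>K\<^esub>),
     ring.zero = (\<lambda>\<sigma>\<in>Mor G. \<zero>\<^bsub>K\<^esub>),
     ring.add = (\<lambda>h l. \<lambda>\<sigma>\<in>Mor G. h \<sigma> \<oplus>\<^bsub>K\<^esub> l \<sigma>),
     smult = (\<lambda>c h. \<lambda>\<sigma>\<in>Mor G. c \<otimes>\<^bsub>K\<^esub> h \<sigma>)\<rparr>"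


section \<open>Module algebras over a groupoid\<close>

text \<open>The locale \<open>algebra\<close> of the library requires commutativity, which is not wanted here.\<close>

locale unital_algebra = module K A + ring A for K (structure) and A (structure) +
  assumes smult_mult_left:
      "\<lbrakk>c \<in> carrier K; a \<in> carrier A; b \<in> carrier A\<rbrakk>
        \<Longrightarrow> (c \<odot>\<^bsub>A\<^esub> a) \<otimes>\<^bsub>A\<^esub> b = c \<odot>\<^bsub>A\<^esub> (a \<otimes>\<^bsub>A\<^esub> b)"
    and smult_mult_right:
      "\<lbrakk>c \<in> carrier K; a \<in> carrier A; b \<in> carrier A\<rbrakk>
        \<Longrightarrow> a \<otimes>\<^bsub>A\<^esub> (c \<odot>\<^bsub>A\<^esub> b) = c \<odot>\<^bsub>A\<^esub> (a \<otimes>\<^bsub>A\<^esub> b)"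

text \<open>The laws of a unital left \<open>R\<close>-module with a not necessarily commutative \<open>R\<close>; the action is a
  separate argument because \<open>smult\<close> already holds the scalar action of \<open>K\<close>.\<close>

locale left_module = abelian_group M
  for R :: "('r, 'x) ring_scheme" and M :: "('a, 'y) ring_scheme" and act :: "'r \<Rightarrow> 'a \<Rightarrow> 'a" +
  assumes act_closed: "\<lbrakk>u \<in> carrier R; a \<in> carrier M\<rbrakk> \<Longrightarrow> act u a \<in> carrier M"
    and act_add_left:
      "\<lbrakk>u \<in> carrier R; w \<in> carrier R; a \<in> carrier M\<rbrakk>
        \<Longrightarrow> act (u \<oplus>\<^bsub>R\<^esub> w) a = act u a \<oplus>\<^bsub>M\<^esub> act w a"
    and act_add_right:
      "\<lbrakk>u \<in> carrier R; a \<in> carrier M; b \<in> carrier M\<rbrakk>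
        \<Longrightarrow> act u (a \<oplus>\<^bsub>M\<^esub> b) = act u a \<oplus>\<^bsub>M\<^esub> act u b"
    and act_mult:
      "\<lbrakk>u \<in> carrier R; w \<in> carrier R; a \<in> carrier M\<rbrakk>
        \<Longrightarrow> act (u \<otimes>\<^bsub>R\<^esub> w) a = act u (act w a)"
    and act_one: "a \<in> carrier M \<Longrightarrow> act \<one>\<^bsub>R\<^esub> a = a"

text \<open>\<open>act_smult\<close> says that the \<open>K\<close>-module structure underlying the \<open>kG\<close>-module \<open>A\<close> is that of the
  \<open>K\<close>-algebra \<open>A\<close>.  Condition \<open>act_unit\<close> is the first of the three equivalent conditions
  \<open>\<sigma>\<cdot>1 = t(\<sigma>)\<cdot>1\<close>, \<open>a(\<sigma>\<cdot>1) = t(\<sigma>)\<cdot>a\<close>, \<open>(\<sigma>\<cdot>1)a = t(\<sigma>)\<cdot>a\<close>.\<close>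

locale left_groupoid_module_algebra =
  unital_algebra K A + kG_module: left_module "groupoid_algebra K G" A act
  for K (structure) and G and A (structure) and act +
  assumes act_smult:
      "\<lbrakk>c \<in> carrier K; u \<in> carrier (groupoid_algebra K G); a \<in> carrier A\<rbrakk>
        \<Longrightarrow> act (c \<odot>\<^bsub>groupoid_algebra K G\<^esub> u) a = c \<odot>\<^bsub>A\<^esub> act u a"
    and act_product:
      "\<lbrakk>\<sigma> \<in> Mor G; a \<in> carrier A; b \<in> carrier A\<rbrakk>
        \<Longrightarrow> act (basis K G \<sigma>) (a \<otimes>\<^bsub>A\<^esub> b) =
            act (basis K G \<sigma>) a \<otimes>\<^bsub>A\<^esub> act (basis K G \<sigma>) b"
    and act_unit:
      "\<sigma> \<in> Mor G \<Longrightarrow>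
        act (basis K G \<sigma>) \<one>\<^bsub>A\<^esub> = act (basis K G (ide G (tgt G \<sigma>))) \<one>\<^bsub>A\<^esub>"


section \<open>The ring of twisted homomorphisms\<close>

text \<open>Sweedler sums.  With \<open>\<rho>(a) = \<Sum>\<^sub>\<sigma> \<sigma>\<cdot>a \<otimes> v\<^sub>\<sigma>\<close>, the expression \<open>\<Phi>(a\<^bsub>[0]\<^esub>, a\<^bsub>[1]\<^esub>)\<close> is
  \<open>coaction_sum K G A act a \<Phi>\<close>; with \<open>\<Delta>(v\<^sub>\<sigma>) = \<Sum>\<^bsub>\<tau>\<kappa>=\<sigma>\<^esub> v\<^sub>\<tau> \<otimes> v\<^sub>\<kappa>\<close>, extended linearly to
  \<open>h = \<Sum>\<^sub>\<sigma> h(\<sigma>) v\<^sub>\<sigma>\<close>, the expression \<open>\<Phi>(h\<^bsub>(1)\<^esub>, h\<^bsub>(2)\<^esub>)\<close> is \<open>coproduct_sum K G A h \<Phi>\<close>.\<close>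

definition coaction_sum ::
  "('k, 'x) ring_scheme \<Rightarrow> ('o, 'm, 'z) groupoid_scheme \<Rightarrow> ('k, 'a, 'y) module_scheme \<Rightarrow>
   (('m \<Rightarrow> 'k) \<Rightarrow> 'a \<Rightarrow> 'a) \<Rightarrow> 'a \<Rightarrow> ('a \<Rightarrow> ('m \<Rightarrow> 'k) \<Rightarrow> 'a) \<Rightarrow> 'a" where
  "coaction_sum K G A act a \<Phi> =
    (\<Oplus>\<^bsub>A\<^esub>\<sigma> \<in> Mor G. \<Phi> (act (basis K G \<sigma>) a) (basis K G \<sigma>))"

definition coproduct_sum ::
  "('k, 'x) ring_scheme \<Rightarrow> ('o, 'm, 'z) groupoid_scheme \<Rightarrow> ('k, 'a, 'y) module_scheme \<Rightarrow>
   ('m \<Rightarrow> 'k) \<Rightarrow> (('m \<Rightarrow> 'k) \<Rightarrow> ('m \<Rightarrow> 'k) \<Rightarrow> 'a) \<Rightarrow> 'a" where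
  "coproduct_sum K G A h \<Phi> =
    (\<Oplus>\<^bsub>A\<^esub>\<sigma> \<in> Mor G. h \<sigma> \<odot>\<^bsub>A\<^esub>
      finsum A (\<lambda>(\<tau>, \<kappa>). \<Phi> (basis K G \<tau>) (basis K G \<kappa>)) (factorizations G \<sigma>))"

definition linear_maps ::
  "('k, 'x) ring_scheme \<Rightarrow> ('k, 'b, 'y) module_scheme \<Rightarrow> ('k, 'c, 'z) module_scheme \<Rightarrow>
   ('b \<Rightarrow> 'c) set" where
  "linear_maps K M N =
    {f \<in> carrier M \<rightarrow>\<^sub>E carrier N.
      (\<forall>x\<in>carrier M. \<forall>y\<in>carrier M. f (x \<oplus>\<^bsub>M\<^esub> y) = f x \<oplus>\<^bsub>N\<^esub> f y) \<and>
      (\<forall>c\<in>carrier K. \<forall>x\<in>carrier M. f (c \<odot>\<^bsub>M\<^esub> x) = c \<odot>\<^bsub>N\<^esub> f x)}"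

definition hom_j ::
  "('k, 'x) ring_scheme \<Rightarrow> ('o, 'm, 'z) groupoid_scheme \<Rightarrow> ('k, 'a, 'y) module_scheme \<Rightarrow>
   (('m \<Rightarrow> 'k) \<Rightarrow> 'a \<Rightarrow> 'a) \<Rightarrow> 'a \<Rightarrow> (('m \<Rightarrow> 'k) \<Rightarrow> 'a)" where
  "hom_j K G A act a =
    (\<lambda>h \<in> carrier (dual_groupoid_algebra K G).
      \<Oplus>\<^bsub>A\<^esub>x \<in> Ob G. h (ide G x) \<odot>\<^bsub>A\<^esub> (act (basis K G (ide G x)) \<one>\<^bsub>A\<^esub> \<otimes>\<^bsub>A\<^esub> a))"

text \<open>The carrier consists of the linear \<open>f : Gk \<rightarrow> A\<close> with \<open>1\<^bsub>[0]\<^esub> f(v\<^sub>\<tau> 1\<^bsub>[1]\<^esub>) = f(v\<^sub>\<tau>)\<close>, and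
  \<open>(f # g)(h) = f(h\<^bsub>(2)\<^esub>)\<^bsub>[0]\<^esub> g(h\<^bsub>(1)\<^esub> f(h\<^bsub>(2)\<^esub>)\<^bsub>[1]\<^esub>)\<close>.  The unit for
  \<open>#\<close> is \<open>j(1)\<close>.\<close>

definition hom_ring ::
  "('k, 'x) ring_scheme \<Rightarrow> ('o, 'm, 'z) groupoid_scheme \<Rightarrow> ('k, 'a, 'y) module_scheme \<Rightarrow>
   (('m \<Rightarrow> 'k) \<Rightarrow> 'a \<Rightarrow> 'a) \<Rightarrow> (('m \<Rightarrow> 'k) \<Rightarrow> 'a) ring" where
  "hom_ring K G A act = (let Gk = dual_groupoid_algebra K G in
    \<lparr>carrier = {f \<in> linear_maps K Gk A. \<forall>\<tau> \<in> Mor G.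
       coaction_sum K G A act \<one>\<^bsub>A\<^esub> (\<lambda>a l. a \<otimes>\<^bsub>A\<^esub> f (basis K G \<tau> \<otimes>\<^bsub>Gk\<^esub> l)) = f (basis K G \<tau>)},
     monoid.mult = (\<lambda>f g. \<lambda>h \<in> carrier Gk.
       coproduct_sum K G A h (\<lambda>h1 h2.
         coaction_sum K G A act (f h2) (\<lambda>a l. a \<otimes>\<^bsub>A\<^esub> g (h1 \<otimes>\<^bsub>Gk\<^esub> l)))),
     one = hom_j K G A act \<one>\<^bsub>A\<^esub>,
     ring.zero = (\<lambda>h \<in> carrier Gk. \<zero>\<^bsub>A\<^esub>),
     ring.add = (\<lambda>f g. \<lambda>h \<in> carrier Gk. f h \<oplus>\<^bsub>A\<^esub> g h)\<rparr>)"


section \<open>Frobenius ring morphisms\<close>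

text \<open>For a ring morphism \<open>i : A \<rightarrow> R\<close>, the abelian group \<open>R \<otimes>\<^sub>A R\<close> is the free abelian group on
  \<open>R \<times> R\<close> modulo biadditivity and \<open>A\<close>-balancedness.  It is a multiplicatively written library group,
  so sums in it are \<open>finprod\<close>s.\<close>

definition tensor_relators ::
  "('a, 'x) ring_scheme \<Rightarrow> ('r, 'y) ring_scheme \<Rightarrow> ('a \<Rightarrow> 'r) \<Rightarrow> ('r \<times> 'r \<Rightarrow>\<^sub>0 int) set" where
  "tensor_relators A R i =
    {frag_of (r \<oplus>\<^bsub>R\<^esub> r', s) - frag_of (r, s) - frag_of (r', s) | r r' s.
      r \<in> carrier R \<and> r' \<in> carrier R \<and> s \<in> carrier R} \<union>
    {frag_of (r, s \<oplus>\<^bsub>R\<^esub> s') - frag_of (r, s) - frag_of (r, s') | r s s'.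
      r \<in> carrier R \<and> s \<in> carrier R \<and> s' \<in> carrier R} \<union>
    {frag_of (r \<otimes>\<^bsub>R\<^esub> i a, s) - frag_of (r, i a \<otimes>\<^bsub>R\<^esub> s) | r a s.
      r \<in> carrier R \<and> a \<in> carrier A \<and> s \<in> carrier R}"

definition tensor_relations ::
  "('a, 'x) ring_scheme \<Rightarrow> ('r, 'y) ring_scheme \<Rightarrow> ('a \<Rightarrow> 'r) \<Rightarrow> ('r \<times> 'r \<Rightarrow>\<^sub>0 int) set" where
  "tensor_relations A R i =
    generate (free_Abelian_group (carrier R \<times> carrier R)) (tensor_relators A R i)"

definition tensor_group ::
  "('a, 'x) ring_scheme \<Rightarrow> ('r, 'y) ring_scheme \<Rightarrow> ('a \<Rightarrow> 'r) \<Rightarrow>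
   ('r \<times> 'r \<Rightarrow>\<^sub>0 int) set monoid" where
  "tensor_group A R i =
    free_Abelian_group (carrier R \<times> carrier R) Mod tensor_relations A R i"

definition pure_tensor ::
  "('a, 'x) ring_scheme \<Rightarrow> ('r, 'y) ring_scheme \<Rightarrow> ('a \<Rightarrow> 'r) \<Rightarrow> 'r \<Rightarrow> 'r \<Rightarrow>
   ('r \<times> 'r \<Rightarrow>\<^sub>0 int) set" where
  "pure_tensor A R i r s =
    tensor_relations A R i #>\<^bsub>free_Abelian_group (carrier R \<times> carrier R)\<^esub> frag_of (r, s)"

definition bimodule_maps ::
  "('a, 'x) ring_scheme \<Rightarrow> ('r, 'y) ring_scheme \<Rightarrow> ('a \<Rightarrow> 'r) \<Rightarrow> ('r \<Rightarrow> 'a) set" where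
  "bimodule_maps A R i =
    {\<nu> \<in> carrier R \<rightarrow> carrier A.
      (\<forall>r\<in>carrier R. \<forall>s\<in>carrier R. \<nu> (r \<oplus>\<^bsub>R\<^esub> s) = \<nu> r \<oplus>\<^bsub>A\<^esub> \<nu> s) \<and>
      (\<forall>a\<in>carrier A. \<forall>r\<in>carrier R. \<nu> (i a \<otimes>\<^bsub>R\<^esub> r) = a \<otimes>\<^bsub>A\<^esub> \<nu> r) \<and>
      (\<forall>a\<in>carrier A. \<forall>r\<in>carrier R. \<nu> (r \<otimes>\<^bsub>R\<^esub> i a) = \<nu> r \<otimes>\<^bsub>A\<^esub> a)}"

text \<open>The tensor \<open>e = e\<^sup>1 \<otimes> e\<^sup>2\<close> (summation understood) is given by a representation
  \<open>\<Sum>\<^bsub>m<n\<^esub> p m \<otimes> q m\<close>, which every element of \<open>R \<otimes>\<^sub>A R\<close> has.  None of the conditions depends on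
  the choice of the representation, \<open>\<nu>\<close> being a bimodule map.\<close>

definition frobenius_morphism ::
  "('a, 'x) ring_scheme \<Rightarrow> ('r, 'y) ring_scheme \<Rightarrow> ('a \<Rightarrow> 'r) \<Rightarrow> bool" where
  "frobenius_morphism A R i \<longleftrightarrow>
    ring A \<and> ring R \<and> i \<in> ring_hom A R \<and>
    (\<exists>\<nu> \<in> bimodule_maps A R i. \<exists>(n::nat) p q.
      p \<in> {..<n} \<rightarrow> carrier R \<and> q \<in> {..<n} \<rightarrow> carrier R \<and>
      (\<forall>r \<in> carrier R.
        finprod (tensor_group A R i) (\<lambda>m. pure_tensor A R i (r \<otimes>\<^bsub>R\<^esub> p m) (q m)) {..<n} =
        finprod (tensor_group A R i) (\<lambda>m. pure_tensor A R i (p m) (q m \<otimes>\<^bsub>R\<^esub> r)) {..<n}) \<and>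
      (\<Oplus>\<^bsub>R\<^esub>m \<in> {..<n}. i (\<nu> (p m)) \<otimes>\<^bsub>R\<^esub> q m) = \<one>\<^bsub>R\<^esub> \<and>
      (\<Oplus>\<^bsub>R\<^esub>m \<in> {..<n}. p m \<otimes>\<^bsub>R\<^esub> i (\<nu> (q m))) = \<one>\<^bsub>R\<^esub>)"

end

theory Submission
  imports Defs
begin

text \<open>The identities of \<open>G\<close> give orthogonal central idempotents \<open>e\<^sub>x = x\<cdot>1\<close> with sum \<open>1\<close>, and a map
  \<open>f\<close> in the ring of twisted homomorphisms amounts to a family \<open>f(v\<^sub>\<sigma>) \<in> e\<^bsub>t(\<sigma>)\<^esub>A\<close>, multiplied by
  \<open>(f # g)(v\<^sub>\<sigma>) = \<Sum>\<^bsub>\<tau>\<kappa>=\<sigma>\<^esub> (\<tau>\<cdot>f(v\<^sub>\<kappa>)) g(v\<^sub>\<tau>)\<close>.  Let \<open>u\<^sub>\<sigma>\<close> be the family with the single entry \<open>e\<^bsub>t(\<sigma>)\<^esub>\<close>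
  at \<open>\<sigma>\<close>.  The Frobenius system is \<open>\<nu>(f) = \<Sum>\<^sub>x f(v\<^sub>x)\<close> and \<open>e = \<Sum>\<^sub>\<sigma> u\<^sub>\<sigma> \<otimes> u\<^bsub>\<sigma>'\<^esub>\<close> with \<open>\<sigma>'\<close> the inverse
  of \<open>\<sigma>\<close>.  It commutes with \<open>f\<close> because the same coefficients in \<open>A\<close>, namely
  \<open>c\<^bsub>\<rho>\<sigma>\<^esub> = \<sigma>\<cdot>f(v\<^bsub>\<sigma>'\<rho>\<^esub>)\<close>, satisfy \<open>f # u\<^sub>\<sigma> = \<Sum>\<^sub>\<rho> u\<^sub>\<rho> # j(c\<^bsub>\<rho>\<sigma>\<^esub>)\<close> and
  \<open>u\<^bsub>\<rho>'\<^esub> # f = \<Sum>\<^sub>\<sigma> j(c\<^bsub>\<rho>\<sigma>\<^esub>) # u\<^bsub>\<sigma>'\<^esub>\<close>.\<close>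

section \<open>Frobenius systems from dual bases\<close>

lemma (in comm_monoid) finprod_swap:
  assumes "finite S" and "finite T" and "\<And>s t. \<lbrakk>s \<in> S; t \<in> T\<rbrakk> \<Longrightarrow> f s t \<in> carrier G"
  shows "(\<Otimes>s\<in>S. \<Otimes>t\<in>T. f s t) = (\<Otimes>t\<in>T. \<Otimes>s\<in>S. f s t)"
  using assms(1,3)
proof (induction S rule: finite_induct)
  case empty
  then show ?case by simp
next
  case (insert x S)
  have "(\<Otimes>s\<in>insert x S. \<Otimes>t\<in>T. f s t) = (\<Otimes>t\<in>T. f x t) \<otimes> (\<Otimes>s\<in>S. \<Otimes>t\<in>T. f s t)"
    using insert by (subst finprod_insert) auto
  also have "\<dots> = (\<Otimes>t\<in>T. f x t) \<otimes> (\<Otimes>t\<in>T. \<Otimes>s\<in>S. f s t)"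
    using insert by simp
  also have "\<dots> = (\<Otimes>t\<in>T. f x t \<otimes> (\<Otimes>s\<in>S. f s t))"
    using insert by (subst finprod_multf) auto
  also have "\<dots> = (\<Otimes>t\<in>T. \<Otimes>s\<in>insert x S. f s t)"
    using insert by (intro finprod_cong) (auto simp: simp_implies_def)
  finally show ?case .
qed

lemma (in comm_monoid) finprod_bij_betw:
  assumes "bij_betw h S T" and "f \<in> T \<rightarrow> carrier G"
  shows "(\<Otimes>s\<in>S. f (h s)) = (\<Otimes>t\<in>T. f t)"
  using assms finprod_reindex[of f h S] by (auto simp: bij_betw_def)

text \<open>Collapses every Kronecker-delta sum below. The conclusion allows \<open>i\<close> to lie
  outside \<open>S\<close>, since in \<open>groupoid_algebra_mult_basis\<close> the distinguished
  pair need not be a factorization of the given morphism.\<close>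

lemma (in comm_monoid) finprod_delta:
  assumes "finite S" and "\<And>s. s \<in> S \<Longrightarrow> s \<noteq> i \<Longrightarrow> f s = \<one>" and "i \<in> S \<Longrightarrow> f i \<in> carrier G"
  shows "finprod G f S = (if i \<in> S then f i else \<one>)"
proof (cases "i \<in> S")
  case True
  have "finprod G f {i} = f i"
    using True assms(3) finprod_insert[of "{}" i f] by simp
  moreover have "finprod G f S = finprod G f {i}"
    using True assms by (intro finprod_mono_neutral_cong_right) fastforce+
  ultimately show ?thesis using True by simp
next
  case False
  then show ?thesis using assms(2) by (auto intro!: finprod_one_eqI)
qed

section \<open>The tensor square of R over A and Casimir elements\<close>

locale ring_extension = A: ring A + R: ring R
  for A (structure) and R (structure) and i +
  assumes ring_hom: "i \<in> ring_hom A R"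
begin

abbreviation tensor :: "'c \<Rightarrow> 'c \<Rightarrow> ('c \<times> 'c \<Rightarrow>\<^sub>0 int) set" (infix \<open>\<otimes>\<^sub>A\<close> 75) where
  "r \<otimes>\<^sub>A s \<equiv> pure_tensor A R i r s"

lemma hom_carrier: "a \<in> carrier A \<Longrightarrow> i a \<in> carrier R"
  using ring_hom by (rule ring_hom_closed)

lemma tensor_relators_carrier:
  "tensor_relators A R i \<subseteq> carrier (free_Abelian_group (carrier R \<times> carrier R))"
proof -
  have diff: "x - y \<in> carrier (free_Abelian_group B)"
    if "x \<in> carrier (free_Abelian_group B)" "y \<in> carrier (free_Abelian_group B)" for x y and B :: "('c \<times> 'c) set"
    using that keys_diff[of x y] unfolding carrier_free_Abelian_group_iff by blast
  show ?thesis
    unfolding tensor_relators_def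
    by (auto simp del: carrier_free_Abelian_group_iff simp: hom_carrier intro!: diff)
qed

text \<open>The free abelian group is commutative, so the generated subgroup is automatically normal
  and the quotient is again an abelian group.\<close>

lemma tensor_relations_normal:
  "tensor_relations A R i \<lhd> free_Abelian_group (carrier R \<times> carrier R)"
  unfolding tensor_relations_def
  using tensor_relators_carrier
  by (intro comm_group.normal_iff_subgroup[THEN iffD2] abelian_free_Abelian_group
      group.generate_is_subgroup group_free_Abelian_group)

sublocale T: comm_group "tensor_group A R i"
  unfolding tensor_group_def
  using tensor_relations_normal abelian_free_Abelian_group
  by (intro comm_group.abelian_FactGroup normal_imp_subgroup)

text \<open>Each law of the tensor product below needs one relator only, so it is enough to treat
  elements that differ by a single generator of the relations.\<close>

lemma tensor_eqI:
  assumes "x - y \<in> tensor_relators A R i"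
    and "Poly_Mapping.keys x \<subseteq> carrier R \<times> carrier R" and "Poly_Mapping.keys y \<subseteq> carrier R \<times> carrier R"
  shows "tensor_relations A R i #>\<^bsub>free_Abelian_group (carrier R \<times> carrier R)\<^esub> x =
    tensor_relations A R i #>\<^bsub>free_Abelian_group (carrier R \<times> carrier R)\<^esub> y"
proof -
  have "x - y \<in> tensor_relations A R i"
    using assms(1) unfolding tensor_relations_def by (rule generate.incl)
  \<comment> \<open>This is \<open>x = (x - y) + y\<close>.\<close>
  then have "x \<in> tensor_relations A R i #>\<^bsub>free_Abelian_group (carrier R \<times> carrier R)\<^esub> y"
    by (force simp: r_coset_def)
  then show ?thesis
    using group.repr_independence[OF group_free_Abelian_group] assms(3)
      normal_imp_subgroup[OF tensor_relations_normal]
    by (metis carrier_free_Abelian_group_iff)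
qed

lemma tensor_closed: "\<lbrakk>r \<in> carrier R; s \<in> carrier R\<rbrakk> \<Longrightarrow> r \<otimes>\<^sub>A s \<in> carrier (tensor_group A R i)"
  unfolding tensor_group_def pure_tensor_def carrier_FactGroup by (intro imageI) simp

text \<open>Moves a product of two cosets to a sum of representatives, where
  \<open>tensor_eqI\<close> can compare it with a single generator.\<close>

lemma tensor_mult:
  assumes "r \<in> carrier R" "s \<in> carrier R" "r' \<in> carrier R" "s' \<in> carrier R"
  shows "r \<otimes>\<^sub>A s \<otimes>\<^bsub>tensor_group A R i\<^esub> r' \<otimes>\<^sub>A s' =
    tensor_relations A R i #>\<^bsub>free_Abelian_group (carrier R \<times> carrier R)\<^esub> (frag_of (r, s) + frag_of (r', s'))"
  unfolding tensor_group_def pure_tensor_def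
  using normal.rcos_sum[OF tensor_relations_normal, of "frag_of (r, s)" "frag_of (r', s')"] assms
  by simp

lemma keys_frag_of_add:
  "\<lbrakk>x \<in> B; y \<in> B\<rbrakk> \<Longrightarrow> Poly_Mapping.keys (frag_of x + frag_of y) \<subseteq> B"
  using keys_add[of "frag_of x" "frag_of y"] by auto

lemma tensor_add_left:
  assumes "r \<in> carrier R" "r' \<in> carrier R" "s \<in> carrier R"
  shows "(r \<oplus>\<^bsub>R\<^esub> r') \<otimes>\<^sub>A s = r \<otimes>\<^sub>A s \<otimes>\<^bsub>tensor_group A R i\<^esub> r' \<otimes>\<^sub>A s"
proof -
  \<comment> \<open>Rewriting with \<open>diff_diff_add\<close> brings the difference into the
    iterated form in which the relators are defined.\<close>
  have "frag_of (r \<oplus>\<^bsub>R\<^esub> r', s) - (frag_of (r, s) + frag_of (r', s)) \<in> tensor_relators A R i"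
    unfolding tensor_relators_def diff_diff_add[symmetric] using assms by blast
  then show ?thesis
    unfolding tensor_mult[OF assms(1) assms(3) assms(2) assms(3)] unfolding pure_tensor_def
    using assms by (intro tensor_eqI keys_frag_of_add) auto
qed

lemma tensor_add_right:
  assumes "r \<in> carrier R" "s \<in> carrier R" "s' \<in> carrier R"
  shows "r \<otimes>\<^sub>A (s \<oplus>\<^bsub>R\<^esub> s') = r \<otimes>\<^sub>A s \<otimes>\<^bsub>tensor_group A R i\<^esub> r \<otimes>\<^sub>A s'"
proof -
  have "frag_of (r, s \<oplus>\<^bsub>R\<^esub> s') - (frag_of (r, s) + frag_of (r, s')) \<in> tensor_relators A R i"
    unfolding tensor_relators_def diff_diff_add[symmetric] using assms by blast
  then show ?thesis
    unfolding tensor_mult[OF assms(1) assms(2) assms(1) assms(3)] unfolding pure_tensor_def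
    using assms by (intro tensor_eqI keys_frag_of_add) auto
qed

lemma tensor_balanced:
  assumes "r \<in> carrier R" "a \<in> carrier A" "s \<in> carrier R"
  shows "(r \<otimes>\<^bsub>R\<^esub> i a) \<otimes>\<^sub>A s = r \<otimes>\<^sub>A (i a \<otimes>\<^bsub>R\<^esub> s)"
proof -
  have "frag_of (r \<otimes>\<^bsub>R\<^esub> i a, s) - frag_of (r, i a \<otimes>\<^bsub>R\<^esub> s) \<in> tensor_relators A R i"
    unfolding tensor_relators_def using assms by blast
  then show ?thesis
    unfolding pure_tensor_def using assms by (intro tensor_eqI) (auto simp: hom_carrier)
qed

text \<open>By additivity this tensor is idempotent in a group. The neutral element is written as a
  unit because the tensor group is multiplicative; this is the base case for
  \<open>tensor_finsum_left\<close>.\<close>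

lemma tensor_zero_left:
  assumes "s \<in> carrier R"
  shows "\<zero>\<^bsub>R\<^esub> \<otimes>\<^sub>A s = \<one>\<^bsub>tensor_group A R i\<^esub>"
  using tensor_add_left[of "\<zero>\<^bsub>R\<^esub>" "\<zero>\<^bsub>R\<^esub>" s] assms tensor_closed[of "\<zero>\<^bsub>R\<^esub>" s]
  by (metis R.l_zero R.zero_closed T.l_cancel_one')

lemma tensor_zero_right:
  assumes "r \<in> carrier R"
  shows "r \<otimes>\<^sub>A \<zero>\<^bsub>R\<^esub> = \<one>\<^bsub>tensor_group A R i\<^esub>"
  using tensor_add_right[of r "\<zero>\<^bsub>R\<^esub>" "\<zero>\<^bsub>R\<^esub>"] assms tensor_closed[of r "\<zero>\<^bsub>R\<^esub>"]
  by (metis R.l_zero R.zero_closed T.l_cancel_one')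

lemma tensor_finsum_left:
  assumes "finite S" and "f \<in> S \<rightarrow> carrier R" and "s \<in> carrier R"
  shows "(\<Oplus>\<^bsub>R\<^esub>m\<in>S. f m) \<otimes>\<^sub>A s = (\<Otimes>\<^bsub>tensor_group A R i\<^esub>m\<in>S. f m \<otimes>\<^sub>A s)"
  using assms(1,2)
proof (induction S rule: finite_induct)
  case (insert m S)
  then have "(\<lambda>m. f m \<otimes>\<^sub>A s) \<in> S \<rightarrow> carrier (tensor_group A R i)" "f m \<otimes>\<^sub>A s \<in> carrier (tensor_group A R i)"
    using assms(3) by (auto intro!: tensor_closed intro: funcset_mem)
  with insert assms(3) show ?case
    by (simp add: tensor_add_left)
qed (simp add: tensor_zero_left assms)

lemma tensor_finsum_right:
  assumes "finite S" and "f \<in> S \<rightarrow> carrier R" and "r \<in> carrier R"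
  shows "r \<otimes>\<^sub>A (\<Oplus>\<^bsub>R\<^esub>m\<in>S. f m) = (\<Otimes>\<^bsub>tensor_group A R i\<^esub>m\<in>S. r \<otimes>\<^sub>A f m)"
  using assms(1,2)
proof (induction S rule: finite_induct)
  case (insert m S)
  then have "(\<lambda>m. r \<otimes>\<^sub>A f m) \<in> S \<rightarrow> carrier (tensor_group A R i)" "r \<otimes>\<^sub>A f m \<in> carrier (tensor_group A R i)"
    using assms(3) by (auto intro!: tensor_closed intro: funcset_mem)
  with insert assms(3) show ?case
    by (simp add: tensor_add_right)
qed (simp add: tensor_zero_right assms)

text \<open>The matrix \<open>c\<close> describes left multiplication by \<open>r\<close> in the basis \<open>p\<close> and, at the same time,
  right multiplication by \<open>r\<close> in the basis \<open>q\<close>; its entries move across the tensor sign.\<close>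

lemma casimir_commute:
  assumes S: "finite S" and p: "p \<in> S \<rightarrow> carrier R" and q: "q \<in> S \<rightarrow> carrier R"
    and c: "\<And>s t. \<lbrakk>s \<in> S; t \<in> S\<rbrakk> \<Longrightarrow> c s t \<in> carrier A"
    and left: "\<And>t. t \<in> S \<Longrightarrow> r \<otimes>\<^bsub>R\<^esub> p t = (\<Oplus>\<^bsub>R\<^esub>s\<in>S. p s \<otimes>\<^bsub>R\<^esub> i (c s t))"
    and right: "\<And>s. s \<in> S \<Longrightarrow> q s \<otimes>\<^bsub>R\<^esub> r = (\<Oplus>\<^bsub>R\<^esub>t\<in>S. i (c s t) \<otimes>\<^bsub>R\<^esub> q t)"
  shows "(\<Otimes>\<^bsub>tensor_group A R i\<^esub>t\<in>S. (r \<otimes>\<^bsub>R\<^esub> p t) \<otimes>\<^sub>A q t) =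
    (\<Otimes>\<^bsub>tensor_group A R i\<^esub>s\<in>S. p s \<otimes>\<^sub>A (q s \<otimes>\<^bsub>R\<^esub> r))"
proof -
  note pq = funcset_mem[OF p] funcset_mem[OF q]
  have "(r \<otimes>\<^bsub>R\<^esub> p t) \<otimes>\<^sub>A q t = (\<Otimes>\<^bsub>tensor_group A R i\<^esub>s\<in>S. p s \<otimes>\<^sub>A (i (c s t) \<otimes>\<^bsub>R\<^esub> q t))"
    if t: "t \<in> S" for t
  proof -
    have "(r \<otimes>\<^bsub>R\<^esub> p t) \<otimes>\<^sub>A q t = (\<Otimes>\<^bsub>tensor_group A R i\<^esub>s\<in>S. (p s \<otimes>\<^bsub>R\<^esub> i (c s t)) \<otimes>\<^sub>A q t)"
      unfolding left[OF t] using S pq c t by (intro tensor_finsum_left) (auto simp: hom_carrier)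
    also have "\<dots> = (\<Otimes>\<^bsub>tensor_group A R i\<^esub>s\<in>S. p s \<otimes>\<^sub>A (i (c s t) \<otimes>\<^bsub>R\<^esub> q t))"
      using pq c t by (intro T.finprod_cong') (auto simp: tensor_balanced tensor_closed hom_carrier)
    finally show ?thesis .
  qed
  then have "(\<Otimes>\<^bsub>tensor_group A R i\<^esub>t\<in>S. (r \<otimes>\<^bsub>R\<^esub> p t) \<otimes>\<^sub>A q t) =
      (\<Otimes>\<^bsub>tensor_group A R i\<^esub>t\<in>S. \<Otimes>\<^bsub>tensor_group A R i\<^esub>s\<in>S. p s \<otimes>\<^sub>A (i (c s t) \<otimes>\<^bsub>R\<^esub> q t))"
    using pq c by (intro T.finprod_cong') (auto simp: tensor_closed hom_carrier)
  also have "\<dots> = (\<Otimes>\<^bsub>tensor_group A R i\<^esub>s\<in>S. \<Otimes>\<^bsub>tensor_group A R i\<^esub>t\<in>S. p s \<otimes>\<^sub>A (i (c s t) \<otimes>\<^bsub>R\<^esub> q t))"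
    using S pq c by (intro T.finprod_swap) (auto simp: tensor_closed hom_carrier)
  also have "\<dots> = (\<Otimes>\<^bsub>tensor_group A R i\<^esub>s\<in>S. p s \<otimes>\<^sub>A (q s \<otimes>\<^bsub>R\<^esub> r))"
    using S pq c by (intro T.finprod_cong')
      (auto simp: right tensor_finsum_right tensor_closed hom_carrier)
  finally show ?thesis .
qed

text \<open>The definition of a Frobenius morphism indexes the tensor by an initial segment of the
  naturals. An enumeration of \<open>S\<close> removes this, so that the system can be indexed by
  the morphisms of the groupoid. The matrix \<open>c\<close> may depend on \<open>r\<close>.\<close>

lemma frobenius_morphismI:
  fixes S :: "'s set"
  assumes S: "finite S" and p: "p \<in> S \<rightarrow> carrier R" and q: "q \<in> S \<rightarrow> carrier R"
    and \<nu>: "\<nu> \<in> bimodule_maps A R i"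
    and c: "\<And>r s t. \<lbrakk>r \<in> carrier R; s \<in> S; t \<in> S\<rbrakk> \<Longrightarrow> c r s t \<in> carrier A"
    and left: "\<And>r t. \<lbrakk>r \<in> carrier R; t \<in> S\<rbrakk> \<Longrightarrow> r \<otimes>\<^bsub>R\<^esub> p t = (\<Oplus>\<^bsub>R\<^esub>s\<in>S. p s \<otimes>\<^bsub>R\<^esub> i (c r s t))"
    and right: "\<And>r s. \<lbrakk>r \<in> carrier R; s \<in> S\<rbrakk> \<Longrightarrow> q s \<otimes>\<^bsub>R\<^esub> r = (\<Oplus>\<^bsub>R\<^esub>t\<in>S. i (c r s t) \<otimes>\<^bsub>R\<^esub> q t)"
    and one_left: "(\<Oplus>\<^bsub>R\<^esub>s\<in>S. i (\<nu> (p s)) \<otimes>\<^bsub>R\<^esub> q s) = \<one>\<^bsub>R\<^esub>"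
    and one_right: "(\<Oplus>\<^bsub>R\<^esub>s\<in>S. p s \<otimes>\<^bsub>R\<^esub> i (\<nu> (q s))) = \<one>\<^bsub>R\<^esub>"
  shows "frobenius_morphism A R i"
proof -
  obtain h where h: "bij_betw h {..<card S} S"
    using ex_bij_betw_nat_finite[OF S] by (auto simp: atLeast0LessThan)
  note pq = funcset_mem[OF p] funcset_mem[OF q]
  have hS: "h m \<in> S" if "m < card S" for m
    using h that by (auto simp: bij_betw_def)
  have \<nu>_closed: "\<nu> r \<in> carrier A" if "r \<in> carrier R" for r
    using \<nu> that by (auto simp: bimodule_maps_def)
  have "(\<Otimes>\<^bsub>tensor_group A R i\<^esub>m\<in>{..<card S}. (r \<otimes>\<^bsub>R\<^esub> p (h m)) \<otimes>\<^sub>A q (h m)) =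
      (\<Otimes>\<^bsub>tensor_group A R i\<^esub>m\<in>{..<card S}. p (h m) \<otimes>\<^sub>A (q (h m) \<otimes>\<^bsub>R\<^esub> r))"
    if r: "r \<in> carrier R" for r
    using casimir_commute[OF S p q c[OF r] left[OF r] right[OF r]] pq r
      T.finprod_bij_betw[OF h, of "\<lambda>t. (r \<otimes>\<^bsub>R\<^esub> p t) \<otimes>\<^sub>A q t"]
      T.finprod_bij_betw[OF h, of "\<lambda>t. p t \<otimes>\<^sub>A (q t \<otimes>\<^bsub>R\<^esub> r)"]
    by (auto simp: tensor_closed)
  moreover have "(\<Oplus>\<^bsub>R\<^esub>m\<in>{..<card S}. i (\<nu> (p (h m))) \<otimes>\<^bsub>R\<^esub> q (h m)) = \<one>\<^bsub>R\<^esub>"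
    using R.add.finprod_bij_betw[OF h, of "\<lambda>t. i (\<nu> (p t)) \<otimes>\<^bsub>R\<^esub> q t"] one_left pq
    by (auto simp: hom_carrier \<nu>_closed)
  moreover have "(\<Oplus>\<^bsub>R\<^esub>m\<in>{..<card S}. p (h m) \<otimes>\<^bsub>R\<^esub> i (\<nu> (q (h m)))) = \<one>\<^bsub>R\<^esub>"
    using R.add.finprod_bij_betw[OF h, of "\<lambda>t. p t \<otimes>\<^bsub>R\<^esub> i (\<nu> (q t))"] one_right pq
    by (auto simp: hom_carrier \<nu>_closed)
  moreover have "(\<lambda>m. p (h m)) \<in> {..<card S} \<rightarrow> carrier R" "(\<lambda>m. q (h m)) \<in> {..<card S} \<rightarrow> carrier R"
    using pq hS by auto
  ultimately show ?thesis
    unfolding frobenius_morphism_def using A.ring_axioms R.ring_axioms ring_hom \<nu>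
    by (intro conjI bexI[of _ \<nu>] exI[of _ "card S"] exI[of _ "\<lambda>m. p (h m)"] exI[of _ "\<lambda>m. q (h m)"])
      auto
qed

end


section \<open>Groupoid actions on algebras\<close>

context groupoid
begin

definition minv :: "'a \<Rightarrow> 'a" where
  "minv \<sigma> = (SOME \<tau>. \<tau> \<in> Mor G \<and> src G \<tau> = tgt G \<sigma> \<and> tgt G \<tau> = src G \<sigma> \<and>
     cmp G \<tau> \<sigma> = ide G (src G \<sigma>) \<and> cmp G \<sigma> \<tau> = ide G (tgt G \<sigma>))"

lemma
  assumes "\<sigma> \<in> Mor G"
  shows minv_closed: "minv \<sigma> \<in> Mor G"
    and src_minv: "src G (minv \<sigma>) = tgt G \<sigma>"
    and tgt_minv: "tgt G (minv \<sigma>) = src G \<sigma>"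
    and minv_left: "cmp G (minv \<sigma>) \<sigma> = ide G (src G \<sigma>)"
    and minv_right: "cmp G \<sigma> (minv \<sigma>) = ide G (tgt G \<sigma>)"
proof -
  have "\<exists>\<tau>. \<tau> \<in> Mor G \<and> src G \<tau> = tgt G \<sigma> \<and> tgt G \<tau> = src G \<sigma> \<and>
     cmp G \<tau> \<sigma> = ide G (src G \<sigma>) \<and> cmp G \<sigma> \<tau> = ide G (tgt G \<sigma>)"
    using inverse_exists[OF assms] by blast
  from someI_ex[OF this, folded minv_def]
  show "minv \<sigma> \<in> Mor G" "src G (minv \<sigma>) = tgt G \<sigma>" "tgt G (minv \<sigma>) = src G \<sigma>"
    "cmp G (minv \<sigma>) \<sigma> = ide G (src G \<sigma>)" "cmp G \<sigma> (minv \<sigma>) = ide G (tgt G \<sigma>)"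
    by blast+
qed

lemmas groupoid_simps [simp] = src_closed tgt_closed ide_closed src_ide tgt_ide cmp_closed src_cmp
  tgt_cmp ide_left ide_right minv_closed src_minv tgt_minv minv_left minv_right

lemma inj_on_ide: "inj_on (ide G) (Ob G)"
  by (rule inj_on_inverseI[of _ "src G"]) simp

lemma minv_cmp_cancel [simp]:
  "\<lbrakk>\<sigma> \<in> Mor G; \<tau> \<in> Mor G; tgt G \<tau> = src G \<sigma>\<rbrakk> \<Longrightarrow> cmp G (minv \<sigma>) (cmp G \<sigma> \<tau>) = \<tau>"
  using cmp_assoc[of "minv \<sigma>" \<sigma> \<tau>] by (metis groupoid_simps)

lemma cmp_minv_cancel [simp]:
  "\<lbrakk>\<sigma> \<in> Mor G; \<tau> \<in> Mor G; tgt G \<tau> = tgt G \<sigma>\<rbrakk> \<Longrightarrow> cmp G \<sigma> (cmp G (minv \<sigma>) \<tau>) = \<tau>"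
  using cmp_assoc[of \<sigma> "minv \<sigma>" \<tau>] by (metis groupoid_simps)

text \<open>The choice behind \<open>minv\<close> does not make it an involution by itself.
  Cancelling \<open>minv \<sigma>\<close> in its composite with \<open>\<sigma>\<close>, which is an
  identity, leaves \<open>minv (minv \<sigma>)\<close> on one side and \<open>\<sigma>\<close> on
  the other.\<close>

lemma minv_minv [simp]: "\<sigma> \<in> Mor G \<Longrightarrow> minv (minv \<sigma>) = \<sigma>"
  using minv_cmp_cancel[of "minv \<sigma>" \<sigma>] ide_right[of "minv (minv \<sigma>)"] by simp

end


section \<open>The action of single morphisms and the central idempotents of A\<close>

locale finite_groupoid_module_algebra =
  A: ring A + groupoid G + left_groupoid_module_algebra K G A act
  for K :: "('k, 'x) ring_scheme" and G :: "('o, 'm, 'z) groupoid_scheme"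
    and A :: "('k, 'a, 'y) module_scheme" (structure) and act +
  assumes finite_Mor: "finite (Mor G)"
begin

abbreviation action :: "'m \<Rightarrow> 'a \<Rightarrow> 'a" (infixr \<open>\<cdot>\<close> 75) where
  "\<sigma> \<cdot> a \<equiv> act (basis K G \<sigma>) a"

definition unit_at :: "'o \<Rightarrow> 'a" where
  "unit_at x = ide G x \<cdot> \<one>"

lemma finite_Ob: "finite (Ob G)"
  by (rule inj_on_finite[OF inj_on_ide _ finite_Mor]) auto

lemma finite_factorizations: "finite (factorizations G \<sigma>)"
  by (rule finite_subset[of _ "Mor G \<times> Mor G"]) (auto simp: factorizations_def finite_Mor)

lemma basis_closed: "basis K G \<sigma> \<in> Mor G \<rightarrow>\<^sub>E carrier K"
  by (auto simp: basis_def)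

lemma carrier_groupoid_algebra: "carrier (groupoid_algebra K G) = Mor G \<rightarrow>\<^sub>E carrier K"
  by (simp add: groupoid_algebra_def)

text \<open>In the convolution sum at \<open>\<rho>\<close> only the pair
  \<open>(\<sigma>, \<tau>)\<close> has a nonzero coefficient, and it occurs exactly when the two
  are composable with composite \<open>\<rho>\<close>.\<close>

lemma groupoid_algebra_mult_basis:
  assumes "\<sigma> \<in> Mor G" "\<tau> \<in> Mor G"
  shows "basis K G \<sigma> \<otimes>\<^bsub>groupoid_algebra K G\<^esub> basis K G \<tau> =
    (if tgt G \<tau> = src G \<sigma> then basis K G (cmp G \<sigma> \<tau>) else \<zero>\<^bsub>groupoid_algebra K G\<^esub>)"
proof -
  have "finsum K (\<lambda>(\<alpha>, \<beta>). basis K G \<sigma> \<alpha> \<otimes>\<^bsub>K\<^esub> basis K G \<tau> \<beta>) (factorizations G \<rho>) =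
    (if (\<sigma>, \<tau>) \<in> factorizations G \<rho> then \<one>\<^bsub>K\<^esub> else \<zero>\<^bsub>K\<^esub>)" for \<rho>
    using assms by (subst R.add.finprod_delta[where i = "(\<sigma>, \<tau>)"])
      (auto simp: finite_factorizations, auto simp: factorizations_def basis_def split: if_split_asm)
  then show ?thesis
    using assms by (auto simp: groupoid_algebra_def basis_def factorizations_def fun_eq_iff)
qed

lemma action_closed [simp]: "a \<in> carrier A \<Longrightarrow> \<sigma> \<cdot> a \<in> carrier A"
  by (simp add: kG_module.act_closed carrier_groupoid_algebra basis_closed)

lemma action_add: "\<lbrakk>a \<in> carrier A; b \<in> carrier A\<rbrakk> \<Longrightarrow> \<sigma> \<cdot> (a \<oplus> b) = \<sigma> \<cdot> a \<oplus> \<sigma> \<cdot> b"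
  by (simp add: kG_module.act_add_right carrier_groupoid_algebra basis_closed)

lemma action_zero [simp]: "\<sigma> \<cdot> \<zero> = \<zero>"
  using action_add[of \<zero> \<zero> \<sigma>] by (metis A.add.l_cancel_one' A.l_zero A.zero_closed action_closed)

lemma action_finsum:
  assumes "finite S" and "f \<in> S \<rightarrow> carrier A"
  shows "\<sigma> \<cdot> (\<Oplus>s\<in>S. f s) = (\<Oplus>s\<in>S. \<sigma> \<cdot> f s)"
  using assms by (induction S rule: finite_induct) (auto simp: action_add Pi_iff)

text \<open>The module laws do not list this rule; it follows since zero plus zero is zero and
  additive groups cancel. It makes the action of a non-composable product vanish.\<close>

lemma act_zero:
  assumes "a \<in> carrier A"
  shows "act \<zero>\<^bsub>groupoid_algebra K G\<^esub> a = \<zero>"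
proof -
  have z: "\<zero>\<^bsub>groupoid_algebra K G\<^esub> \<in> carrier (groupoid_algebra K G)"
    "\<zero>\<^bsub>groupoid_algebra K G\<^esub> \<oplus>\<^bsub>groupoid_algebra K G\<^esub> \<zero>\<^bsub>groupoid_algebra K G\<^esub> = \<zero>\<^bsub>groupoid_algebra K G\<^esub>"
    by (auto simp: groupoid_algebra_def)
  show ?thesis
    using kG_module.act_add_left[OF z(1) z(1) assms] kG_module.act_closed[OF z(1) assms]
    unfolding z(2) by (metis A.add.l_cancel_one')
qed

lemma action_action:
  assumes "\<sigma> \<in> Mor G" "\<tau> \<in> Mor G" "a \<in> carrier A"
  shows "\<sigma> \<cdot> \<tau> \<cdot> a = (if tgt G \<tau> = src G \<sigma> then cmp G \<sigma> \<tau> \<cdot> a else \<zero>)"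
proof -
  have "\<sigma> \<cdot> \<tau> \<cdot> a = act (basis K G \<sigma> \<otimes>\<^bsub>groupoid_algebra K G\<^esub> basis K G \<tau>) a"
    using assms by (simp add: kG_module.act_mult carrier_groupoid_algebra basis_closed)
  then show ?thesis
    using assms by (simp add: groupoid_algebra_mult_basis act_zero)
qed

text \<open>The unit of the groupoid algebra is the sum of all identities, and it acts
  trivially.\<close>

lemma sum_ide_action:
  assumes a: "a \<in> carrier A"
  shows "(\<Oplus>x\<in>Ob G. ide G x \<cdot> a) = a"
proof -
  \<comment> \<open>Additivity of the action is available for two summands only, hence an induction
    over sets \<open>B\<close> of objects, through the indicator functions of their
    identities.\<close>
  have ind: "act (\<lambda>\<sigma>\<in>Mor G. if \<sigma> \<in> ide G ` B then \<one>\<^bsub>K\<^esub> else \<zero>\<^bsub>K\<^esub>) a = (\<Oplus>x\<in>B. ide G x \<cdot> a)"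
    if "finite B" "B \<subseteq> Ob G" for B
    using that
  proof (induction B rule: finite_induct)
    case empty
    then show ?case
      using act_zero[OF a] by (simp add: groupoid_algebra_def restrict_def)
  next
    case (insert x B)
    let ?u = "\<lambda>\<sigma>\<in>Mor G. if \<sigma> \<in> ide G ` B then \<one>\<^bsub>K\<^esub> else \<zero>\<^bsub>K\<^esub>"
    \<comment> \<open>Disjoint supports are needed: otherwise the coefficient at
      \<open>ide G x\<close> would be counted twice.\<close>
    have notin: "ide G x \<notin> ide G ` B"
      using insert by (subst inj_on_image_mem_iff[OF inj_on_ide]) auto
    have "(\<lambda>\<sigma>\<in>Mor G. if \<sigma> \<in> ide G ` insert x B then \<one>\<^bsub>K\<^esub> else \<zero>\<^bsub>K\<^esub>) =
        basis K G (ide G x) \<oplus>\<^bsub>groupoid_algebra K G\<^esub> ?u"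
      using notin by (auto simp: groupoid_algebra_def basis_def fun_eq_iff)
    moreover have "?u \<in> carrier (groupoid_algebra K G)"
      by (auto simp: carrier_groupoid_algebra)
    ultimately show ?case
      using insert a
      by (simp add: kG_module.act_add_left carrier_groupoid_algebra basis_closed restrict_def)
  qed
  show ?thesis
    using ind[OF finite_Ob] kG_module.act_one[OF a] by (simp add: groupoid_algebra_def)
qed

text \<open>Each \<open>ide x\<close> annihilates one of the two factors, and the \<open>ide x\<close> sum up to \<open>1\<close>.\<close>

lemma ide_action_orthogonal:
  assumes "x \<in> Ob G" "y \<in> Ob G" "x \<noteq> y" "a \<in> carrier A" "b \<in> carrier A"
  shows "(ide G x \<cdot> a) \<otimes> (ide G y \<cdot> b) = \<zero>"
proof -
  have "ide G z \<cdot> ((ide G x \<cdot> a) \<otimes> (ide G y \<cdot> b)) = \<zero>" if "z \<in> Ob G" for z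
    using assms that by (auto simp: act_product action_action)
  then have "(\<Oplus>z\<in>Ob G. ide G z \<cdot> ((ide G x \<cdot> a) \<otimes> (ide G y \<cdot> b))) = \<zero>"
    by (intro A.add.finprod_one_eqI)
  then show ?thesis
    using assms by (simp add: sum_ide_action)
qed

lemma unit_at_closed [simp]: "unit_at x \<in> carrier A"
  by (simp add: unit_at_def)

text \<open>Split \<open>a\<close> into its components \<open>ide G y \<cdot> a\<close>.
  Orthogonality kills all but the one at \<open>x\<close>, and there multiplicativity of
  \<open>ide G x\<close> absorbs the unit. Together with \<open>mult_unit_at\<close> this makes
  \<open>unit_at x\<close> central.\<close>

lemma unit_at_mult:
  assumes x: "x \<in> Ob G" and a: "a \<in> carrier A"
  shows "unit_at x \<otimes> a = ide G x \<cdot> a"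
proof -
  have "unit_at x \<otimes> a = unit_at x \<otimes> (\<Oplus>y\<in>Ob G. ide G y \<cdot> a)"
    using a by (simp add: sum_ide_action)
  also have "\<dots> = (\<Oplus>y\<in>Ob G. unit_at x \<otimes> (ide G y \<cdot> a))"
    using a by (intro A.finsum_rdistr) (auto simp: finite_Ob)
  also have "\<dots> = unit_at x \<otimes> (ide G x \<cdot> a)"
    using x a by (subst A.add.finprod_delta[where i = x])
      (auto simp: finite_Ob unit_at_def ide_action_orthogonal)
  also have "\<dots> = ide G x \<cdot> a"
    using x a act_product[of "ide G x" \<one> a] by (simp add: unit_at_def)
  finally show ?thesis .
qed

lemma mult_unit_at:
  assumes x: "x \<in> Ob G" and a: "a \<in> carrier A"
  shows "a \<otimes> unit_at x = ide G x \<cdot> a"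
proof -
  have "a \<otimes> unit_at x = (\<Oplus>y\<in>Ob G. ide G y \<cdot> a) \<otimes> unit_at x"
    using a by (simp add: sum_ide_action)
  also have "\<dots> = (\<Oplus>y\<in>Ob G. (ide G y \<cdot> a) \<otimes> unit_at x)"
    using a by (intro A.finsum_ldistr) (auto simp: finite_Ob)
  also have "\<dots> = (ide G x \<cdot> a) \<otimes> unit_at x"
    using x a by (subst A.add.finprod_delta[where i = x])
      (auto simp: finite_Ob unit_at_def ide_action_orthogonal)
  also have "\<dots> = ide G x \<cdot> a"
    using x a act_product[of "ide G x" a \<one>] by (simp add: unit_at_def)
  finally show ?thesis .
qed

lemma action_one: "\<sigma> \<in> Mor G \<Longrightarrow> \<sigma> \<cdot> \<one> = unit_at (tgt G \<sigma>)"
  unfolding unit_at_def by (rule act_unit)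

lemma action_unit_at: "\<lbrakk>\<sigma> \<in> Mor G; x \<in> Ob G\<rbrakk> \<Longrightarrow> \<sigma> \<cdot> unit_at x = (if src G \<sigma> = x then unit_at (tgt G \<sigma>) else \<zero>)"
  using action_one[of \<sigma>] unfolding unit_at_def by (auto simp: action_action)

lemma unit_at_idem: "x \<in> Ob G \<Longrightarrow> unit_at x \<otimes> unit_at x = unit_at x"
  by (simp add: unit_at_mult action_unit_at)

lemma unit_at_mult_action: "\<lbrakk>\<sigma> \<in> Mor G; a \<in> carrier A\<rbrakk> \<Longrightarrow> unit_at (tgt G \<sigma>) \<otimes> (\<sigma> \<cdot> a) = \<sigma> \<cdot> a"
  by (simp add: unit_at_mult action_action)


subsection \<open>The ring of twisted homomorphisms\<close>

abbreviation Gk :: "('k, 'm \<Rightarrow> 'k) module" where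
  "Gk \<equiv> dual_groupoid_algebra K G"

abbreviation H :: "(('m \<Rightarrow> 'k) \<Rightarrow> 'a) ring" where
  "H \<equiv> hom_ring K G A act"

abbreviation j :: "'a \<Rightarrow> ('m \<Rightarrow> 'k) \<Rightarrow> 'a" where
  "j \<equiv> hom_j K G A act"

abbreviation v :: "'m \<Rightarrow> 'm \<Rightarrow> 'k" where
  "v \<equiv> basis K G"

section \<open>Linear maps on Gk and their values on the dual basis\<close>

definition hom_of :: "('m \<Rightarrow> 'a) \<Rightarrow> ('m \<Rightarrow> 'k) \<Rightarrow> 'a" where
  "hom_of w = (\<lambda>h\<in>carrier Gk. \<Oplus>\<sigma>\<in>Mor G. h \<sigma> \<odot> w \<sigma>)"

lemma carrier_Gk: "carrier Gk = Mor G \<rightarrow>\<^sub>E carrier K"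
  by (simp add: dual_groupoid_algebra_def)

lemma v_in_Gk [simp]: "v \<sigma> \<in> carrier Gk"
  by (simp add: carrier_Gk basis_closed)

lemma Gk_closed:
  assumes "h \<in> carrier Gk"
  shows "\<sigma> \<in> Mor G \<Longrightarrow> h \<sigma> \<in> carrier K"
  using assms by (auto simp: carrier_Gk)

lemma zero_in_Gk [simp]: "\<zero>\<^bsub>Gk\<^esub> \<in> carrier Gk"
  by (simp add: dual_groupoid_algebra_def)

lemma Gk_mult_basis:
  assumes "\<sigma> \<in> Mor G"
  shows "v \<sigma> \<otimes>\<^bsub>Gk\<^esub> v \<tau> = (if \<tau> = \<sigma> then v \<sigma> else \<zero>\<^bsub>Gk\<^esub>)"
  using assms by (auto simp: dual_groupoid_algebra_def basis_def fun_eq_iff)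

lemma hom_of_basis:
  assumes "w \<in> Mor G \<rightarrow> carrier A" and "\<sigma> \<in> Mor G"
  shows "hom_of w (v \<sigma>) = w \<sigma>"
proof -
  have "hom_of w (v \<sigma>) = (\<Oplus>\<tau>\<in>Mor G. v \<sigma> \<tau> \<odot> w \<tau>)"
    by (simp add: hom_of_def)
  also have "\<dots> = w \<sigma>"
    using assms by (subst A.add.finprod_delta[where i = \<sigma>]) (auto simp: finite_Mor basis_def Pi_iff)
  finally show ?thesis .
qed

lemma smult_finsum:
  assumes "finite S" and "f \<in> S \<rightarrow> carrier A" and "c \<in> carrier K"
  shows "c \<odot> (\<Oplus>s\<in>S. f s) = (\<Oplus>s\<in>S. c \<odot> f s)"
  using assms by (induction S rule: finite_induct) (auto simp: smult_r_distr Pi_iff)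

lemma hom_of_linear:
  assumes "w \<in> Mor G \<rightarrow> carrier A"
  shows "hom_of w \<in> linear_maps K Gk A"
proof -
  note w = funcset_mem[OF assms]
  have "hom_of w (h \<oplus>\<^bsub>Gk\<^esub> l) = hom_of w h \<oplus> hom_of w l"
    if hl: "h \<in> carrier Gk" "l \<in> carrier Gk" for h l
  proof -
    have "h \<oplus>\<^bsub>Gk\<^esub> l \<in> carrier Gk"
      using hl by (auto simp: dual_groupoid_algebra_def)
    then have "hom_of w (h \<oplus>\<^bsub>Gk\<^esub> l) = (\<Oplus>\<sigma>\<in>Mor G. (h \<oplus>\<^bsub>Gk\<^esub> l) \<sigma> \<odot> w \<sigma>)"
      by (simp add: hom_of_def)
    also have "\<dots> = (\<Oplus>\<sigma>\<in>Mor G. h \<sigma> \<odot> w \<sigma> \<oplus> l \<sigma> \<odot> w \<sigma>)"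
      using hl w by (intro A.finsum_cong')
        (auto simp: Gk_closed, simp add: dual_groupoid_algebra_def smult_l_distr Pi_iff PiE_iff)
    also have "\<dots> = (\<Oplus>\<sigma>\<in>Mor G. h \<sigma> \<odot> w \<sigma>) \<oplus> (\<Oplus>\<sigma>\<in>Mor G. l \<sigma> \<odot> w \<sigma>)"
      using hl w by (intro A.finsum_addf) (auto simp: Gk_closed)
    finally show ?thesis
      using hl by (simp add: hom_of_def)
  qed
  moreover have "hom_of w (c \<odot>\<^bsub>Gk\<^esub> h) = c \<odot> hom_of w h"
    if ch: "c \<in> carrier K" "h \<in> carrier Gk" for c h
  proof -
    have "c \<odot>\<^bsub>Gk\<^esub> h \<in> carrier Gk"
      using ch by (auto simp: dual_groupoid_algebra_def)
    then have "hom_of w (c \<odot>\<^bsub>Gk\<^esub> h) = (\<Oplus>\<sigma>\<in>Mor G. (c \<odot>\<^bsub>Gk\<^esub> h) \<sigma> \<odot> w \<sigma>)"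
      by (simp add: hom_of_def)
    also have "\<dots> = (\<Oplus>\<sigma>\<in>Mor G. c \<odot> (h \<sigma> \<odot> w \<sigma>))"
      using ch w by (intro A.finsum_cong')
        (auto simp: Gk_closed, simp add: dual_groupoid_algebra_def smult_assoc1 Pi_iff PiE_iff)
    also have "\<dots> = c \<odot> (\<Oplus>\<sigma>\<in>Mor G. h \<sigma> \<odot> w \<sigma>)"
      using ch w by (intro smult_finsum[symmetric]) (auto simp: Gk_closed finite_Mor)
    finally show ?thesis
      using ch by (simp add: hom_of_def)
  qed
  moreover have "hom_of w \<in> carrier Gk \<rightarrow>\<^sub>E carrier A"
    using w by (auto simp: hom_of_def Gk_closed intro!: A.finsum_closed)
  ultimately show ?thesis
    by (simp add: linear_maps_def)
qed

lemma
  assumes "f \<in> linear_maps K Gk A"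
  shows linear_closed: "h \<in> carrier Gk \<Longrightarrow> f h \<in> carrier A"
    and linear_extensional: "f \<in> extensional (carrier Gk)"
    and linear_add: "\<lbrakk>h \<in> carrier Gk; l \<in> carrier Gk\<rbrakk> \<Longrightarrow> f (h \<oplus>\<^bsub>Gk\<^esub> l) = f h \<oplus> f l"
    and linear_smult: "\<lbrakk>c \<in> carrier K; h \<in> carrier Gk\<rbrakk> \<Longrightarrow> f (c \<odot>\<^bsub>Gk\<^esub> h) = c \<odot> f h"
  using assms by (auto simp: linear_maps_def PiE_def)

lemma linear_zero:
  assumes "f \<in> linear_maps K Gk A"
  shows "f \<zero>\<^bsub>Gk\<^esub> = \<zero>"
proof -
  have "\<zero>\<^bsub>K\<^esub> \<odot>\<^bsub>Gk\<^esub> \<zero>\<^bsub>Gk\<^esub> = \<zero>\<^bsub>Gk\<^esub>"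
    by (auto simp: dual_groupoid_algebra_def)
  then show ?thesis
    using linear_smult[OF assms, of "\<zero>\<^bsub>K\<^esub>" "\<zero>\<^bsub>Gk\<^esub>"] linear_closed[OF assms, of "\<zero>\<^bsub>Gk\<^esub>"] by simp
qed

text \<open>Induction over the truncations of \<open>h\<close> to subsets \<open>B\<close> of
  \<open>Mor G\<close>, adding one basis vector at a time; for \<open>B = Mor G\<close> the
  truncation is \<open>h\<close> itself because \<open>h\<close> is extensional.\<close>

lemma linear_expand:
  assumes f: "f \<in> linear_maps K Gk A" and h: "h \<in> carrier Gk"
  shows "f h = (\<Oplus>\<sigma>\<in>Mor G. h \<sigma> \<odot> f (v \<sigma>))"
proof -
  have ind: "f (\<lambda>\<sigma>\<in>Mor G. if \<sigma> \<in> B then h \<sigma> else \<zero>\<^bsub>K\<^esub>) = (\<Oplus>\<sigma>\<in>B. h \<sigma> \<odot> f (v \<sigma>))"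
    if "finite B" "B \<subseteq> Mor G" for B
    using that
  proof (induction B rule: finite_induct)
    case empty
    then show ?case
      using linear_zero[OF f] by (simp add: dual_groupoid_algebra_def restrict_def)
  next
    case (insert \<tau> B)
    let ?u = "\<lambda>\<sigma>\<in>Mor G. if \<sigma> \<in> B then h \<sigma> else \<zero>\<^bsub>K\<^esub>"
    have "?u \<in> carrier Gk"
      using h by (auto simp: carrier_Gk)
    moreover have "h \<tau> \<odot>\<^bsub>Gk\<^esub> v \<tau> \<in> carrier Gk"
      using h insert by (auto simp: dual_groupoid_algebra_def basis_def)
    moreover have "(\<lambda>\<sigma>\<in>Mor G. if \<sigma> \<in> insert \<tau> B then h \<sigma> else \<zero>\<^bsub>K\<^esub>) = h \<tau> \<odot>\<^bsub>Gk\<^esub> v \<tau> \<oplus>\<^bsub>Gk\<^esub> ?u"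
      using h insert.prems insert.hyps
      by (auto simp: dual_groupoid_algebra_def basis_def fun_eq_iff PiE_iff)
    ultimately have "f (\<lambda>\<sigma>\<in>Mor G. if \<sigma> \<in> insert \<tau> B then h \<sigma> else \<zero>\<^bsub>K\<^esub>) = h \<tau> \<odot> f (v \<tau>) \<oplus> f ?u"
      using h insert.prems by (simp only:) (simp add: linear_add[OF f] linear_smult[OF f] Gk_closed)
    also have "\<dots> = (\<Oplus>\<sigma>\<in>insert \<tau> B. h \<sigma> \<odot> f (v \<sigma>))"
      using insert h
      by (subst A.add.finprod_insert) (auto simp: Gk_closed linear_closed[OF f] subset_iff restrict_def)
    finally show ?case .
  qed
  have "(\<lambda>\<sigma>\<in>Mor G. if \<sigma> \<in> Mor G then h \<sigma> else \<zero>\<^bsub>K\<^esub>) = h"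
    using h by (auto simp: carrier_Gk fun_eq_iff PiE_iff extensional_def)
  then show ?thesis
    using ind[OF finite_Mor subset_refl] by simp
qed

lemma linear_ext:
  assumes "f \<in> linear_maps K Gk A" "g \<in> linear_maps K Gk A" "\<And>\<sigma>. \<sigma> \<in> Mor G \<Longrightarrow> f (v \<sigma>) = g (v \<sigma>)"
  shows "f = g"
proof (rule extensionalityI)
  show "f h = g h" if h: "h \<in> carrier Gk" for h
    unfolding linear_expand[OF assms(1) h] linear_expand[OF assms(2) h]
    using assms h by (intro A.finsum_cong') (auto simp: Gk_closed linear_closed)
qed (use assms linear_extensional in auto)

text \<open>The basis vectors are orthogonal idempotents, so the Sweedler sum retains only the term
  at \<open>\<tau>\<close>.\<close>

lemma coaction_sum_basis:
  assumes f: "f \<in> linear_maps K Gk A" and "\<tau> \<in> Mor G" and "b \<in> carrier A"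
  shows "coaction_sum K G A act b (\<lambda>a l. a \<otimes> f (v \<tau> \<otimes>\<^bsub>Gk\<^esub> l)) = (\<tau> \<cdot> b) \<otimes> f (v \<tau>)"
  unfolding coaction_sum_def using assms
  by (subst A.add.finprod_delta[where i = \<tau>])
    (auto simp: finite_Mor Gk_mult_basis linear_zero[OF f] linear_closed[OF f])

text \<open>By \<open>coaction_sum_basis\<close> and \<open>action_one\<close>, the twisted
  condition on \<open>f\<close> says only that its value at \<open>v \<tau>\<close> lies in the
  ideal generated by the idempotent at the target of \<open>\<tau>\<close>.\<close>

lemma carrier_hom_ring:
  "carrier H = {f \<in> linear_maps K Gk A. \<forall>\<tau>\<in>Mor G. unit_at (tgt G \<tau>) \<otimes> f (v \<tau>) = f (v \<tau>)}"
  by (auto simp: hom_ring_def Let_def coaction_sum_basis action_one)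

lemma hom_ring_linear: "f \<in> carrier H \<Longrightarrow> f \<in> linear_maps K Gk A"
  by (simp add: carrier_hom_ring)

lemma hom_ring_value_closed [simp]: "f \<in> carrier H \<Longrightarrow> f (v \<sigma>) \<in> carrier A"
  by (simp add: hom_ring_linear linear_closed)

lemma unit_at_mult_value [simp]:
  "\<lbrakk>f \<in> carrier H; \<sigma> \<in> Mor G\<rbrakk> \<Longrightarrow> unit_at (tgt G \<sigma>) \<otimes> f (v \<sigma>) = f (v \<sigma>)"
  by (simp add: carrier_hom_ring)

lemma hom_ring_ext:
  "\<lbrakk>f \<in> carrier H; g \<in> carrier H; \<And>\<sigma>. \<sigma> \<in> Mor G \<Longrightarrow> f (v \<sigma>) = g (v \<sigma>)\<rbrakk> \<Longrightarrow> f = g"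
  by (rule linear_ext) (auto intro: hom_ring_linear)

lemma hom_of_in_hom_ring:
  assumes "\<And>\<sigma>. \<sigma> \<in> Mor G \<Longrightarrow> w \<sigma> \<in> carrier A"
    and "\<And>\<sigma>. \<sigma> \<in> Mor G \<Longrightarrow> unit_at (tgt G \<sigma>) \<otimes> w \<sigma> = w \<sigma>"
  shows "hom_of w \<in> carrier H"
proof -
  have "w \<in> Mor G \<rightarrow> carrier A" using assms(1) by auto
  then show ?thesis
    using assms(2) by (simp add: carrier_hom_ring hom_of_linear hom_of_basis)
qed

section \<open>The product and the morphism j in coordinates\<close>

definition fiber :: "'o \<Rightarrow> 'm set" where
  "fiber x = {\<tau> \<in> Mor G. tgt G \<tau> = x}"

lemma finite_fiber [simp]: "finite (fiber x)"
  unfolding fiber_def using finite_Mor by simp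

text \<open>In a groupoid a factorization of \<open>\<sigma>\<close> is determined by its left
  factor, which can be any morphism with the same target as \<open>\<sigma>\<close>.\<close>

lemma finsum_factorizations:
  assumes "\<sigma> \<in> Mor G"
    and "\<And>\<tau> \<kappa>. (\<tau>, \<kappa>) \<in> factorizations G \<sigma> \<Longrightarrow> f \<tau> \<kappa> \<in> carrier A"
  shows "finsum A (\<lambda>(\<tau>, \<kappa>). f \<tau> \<kappa>) (factorizations G \<sigma>) =
    (\<Oplus>\<tau>\<in>fiber (tgt G \<sigma>). f \<tau> (cmp G (minv \<tau>) \<sigma>))"
proof -
  have "bij_betw (\<lambda>\<tau>. (\<tau>, cmp G (minv \<tau>) \<sigma>)) (fiber (tgt G \<sigma>)) (factorizations G \<sigma>)"
    by (rule bij_betw_byWitness[where f' = fst])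
      (use assms(1) in \<open>auto simp: fiber_def factorizations_def\<close>)
  then have "(\<Oplus>\<tau>\<in>fiber (tgt G \<sigma>). (\<lambda>(\<tau>, \<kappa>). f \<tau> \<kappa>) (\<tau>, cmp G (minv \<tau>) \<sigma>)) =
    finsum A (\<lambda>(\<tau>, \<kappa>). f \<tau> \<kappa>) (factorizations G \<sigma>)"
    using assms(2) by (intro A.add.finprod_bij_betw) auto
  then show ?thesis by simp
qed

text \<open>Both Sweedler sums simplify: the coaction leaves one term by
  \<open>coaction_sum_basis\<close>, and the coproduct becomes a sum over a fiber.\<close>

lemma hom_ring_mult:
  assumes f: "f \<in> carrier H" and g: "g \<in> carrier H"
  shows "f \<otimes>\<^bsub>H\<^esub> g =
    hom_of (\<lambda>\<sigma>. \<Oplus>\<tau>\<in>fiber (tgt G \<sigma>). (\<tau> \<cdot> f (v (cmp G (minv \<tau>) \<sigma>))) \<otimes> g (v \<tau>))"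
proof -
  have "finsum A (\<lambda>(\<tau>, \<kappa>). coaction_sum K G A act (f (v \<kappa>)) (\<lambda>a l. a \<otimes> g (v \<tau> \<otimes>\<^bsub>Gk\<^esub> l))) (factorizations G \<sigma>)
    = (\<Oplus>\<tau>\<in>fiber (tgt G \<sigma>). (\<tau> \<cdot> f (v (cmp G (minv \<tau>) \<sigma>))) \<otimes> g (v \<tau>))" if "\<sigma> \<in> Mor G" for \<sigma>
  proof -
    have "finsum A (\<lambda>(\<tau>, \<kappa>). coaction_sum K G A act (f (v \<kappa>)) (\<lambda>a l. a \<otimes> g (v \<tau> \<otimes>\<^bsub>Gk\<^esub> l))) (factorizations G \<sigma>)
      = finsum A (\<lambda>(\<tau>, \<kappa>). (\<tau> \<cdot> f (v \<kappa>)) \<otimes> g (v \<tau>)) (factorizations G \<sigma>)"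
      using f g by (intro A.finsum_cong')
        (auto simp: factorizations_def coaction_sum_basis hom_ring_linear)
    also have "\<dots> = (\<Oplus>\<tau>\<in>fiber (tgt G \<sigma>). (\<tau> \<cdot> f (v (cmp G (minv \<tau>) \<sigma>))) \<otimes> g (v \<tau>))"
      using f g that by (intro finsum_factorizations) auto
    finally show ?thesis .
  qed
  then show ?thesis
    using f g unfolding hom_of_def
    by (auto simp: hom_ring_def Let_def coproduct_sum_def Gk_closed intro!: restrict_ext A.finsum_cong')
qed

lemma
  assumes f: "f \<in> carrier H" and g: "g \<in> carrier H"
  shows hom_ring_mult_closed: "f \<otimes>\<^bsub>H\<^esub> g \<in> carrier H"
    and hom_ring_mult_value: "\<sigma> \<in> Mor G \<Longrightarrow> (f \<otimes>\<^bsub>H\<^esub> g) (v \<sigma>) =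
      (\<Oplus>\<tau>\<in>fiber (tgt G \<sigma>). (\<tau> \<cdot> f (v (cmp G (minv \<tau>) \<sigma>))) \<otimes> g (v \<tau>))"
proof -
  have summand: "(\<tau> \<cdot> f (v \<kappa>)) \<otimes> g (v \<tau>) \<in> carrier A" for \<tau> \<kappa>
    using f g by simp
  show "f \<otimes>\<^bsub>H\<^esub> g \<in> carrier H"
    unfolding hom_ring_mult[OF assms]
  proof (rule hom_of_in_hom_ring)
    fix \<sigma> assume \<sigma>: "\<sigma> \<in> Mor G"
    \<comment> \<open>All morphisms in the fiber share the target of \<open>\<sigma>\<close>, so the
      idempotent is absorbed by the left factor of each summand.\<close>
    have "unit_at (tgt G \<sigma>) \<otimes> ((\<tau> \<cdot> f (v \<kappa>)) \<otimes> g (v \<tau>)) = (\<tau> \<cdot> f (v \<kappa>)) \<otimes> g (v \<tau>)"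
      if "\<tau> \<in> fiber (tgt G \<sigma>)" for \<tau> \<kappa>
      using that f g unit_at_mult_action[of \<tau> "f (v \<kappa>)"] by (simp add: fiber_def flip: A.m_assoc)
    then show "unit_at (tgt G \<sigma>) \<otimes> (\<Oplus>\<tau>\<in>fiber (tgt G \<sigma>). (\<tau> \<cdot> f (v (cmp G (minv \<tau>) \<sigma>))) \<otimes> g (v \<tau>)) =
      (\<Oplus>\<tau>\<in>fiber (tgt G \<sigma>). (\<tau> \<cdot> f (v (cmp G (minv \<tau>) \<sigma>))) \<otimes> g (v \<tau>))"
      using summand by (subst A.finsum_rdistr) (auto intro!: A.finsum_cong')
  qed (use summand in auto)
  show "(f \<otimes>\<^bsub>H\<^esub> g) (v \<sigma>) = (\<Oplus>\<tau>\<in>fiber (tgt G \<sigma>). (\<tau> \<cdot> f (v (cmp G (minv \<tau>) \<sigma>))) \<otimes> g (v \<tau>))"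
    if "\<sigma> \<in> Mor G"
    unfolding hom_ring_mult[OF assms] using that summand by (subst hom_of_basis) auto
qed

lemma
  assumes a: "a \<in> carrier A"
  shows hom_j_closed: "j a \<in> carrier H"
    and hom_j_value: "\<sigma> \<in> Mor G \<Longrightarrow> j a (v \<sigma>) = (if \<sigma> = ide G (tgt G \<sigma>) then \<sigma> \<cdot> a else \<zero>)"
proof -
  let ?w = "\<lambda>\<sigma>. if \<sigma> = ide G (tgt G \<sigma>) then \<sigma> \<cdot> a else \<zero>"
  \<comment> \<open>The sum over objects is carried to the identity morphisms along the injective
    \<open>ide G\<close> and then extended by zero to all morphisms;
    \<open>\<sigma> = ide G (tgt G \<sigma>)\<close> is the test for being an identity.\<close>
  have "(\<Oplus>x\<in>Ob G. h (ide G x) \<odot> (ide G x \<cdot> \<one> \<otimes> a)) = (\<Oplus>\<sigma>\<in>Mor G. h \<sigma> \<odot> ?w \<sigma>)"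
    if h: "h \<in> carrier Gk" for h
  proof -
    have "(\<Oplus>x\<in>Ob G. h (ide G x) \<odot> (ide G x \<cdot> \<one> \<otimes> a)) = (\<Oplus>x\<in>Ob G. h (ide G x) \<odot> ?w (ide G x))"
      using h a by (intro A.finsum_cong') (auto simp: Gk_closed unit_at_mult simp flip: unit_at_def)
    also have "\<dots> = (\<Oplus>\<sigma>\<in>ide G ` Ob G. h \<sigma> \<odot> ?w \<sigma>)"
      using h a by (intro A.finsum_reindex[symmetric]) (auto simp: Gk_closed inj_on_ide)
    also have "\<dots> = (\<Oplus>\<sigma>\<in>Mor G. h \<sigma> \<odot> ?w \<sigma>)"
      using h a by (intro A.add.finprod_mono_neutral_cong_left) (auto simp: Gk_closed finite_Mor)
    finally show ?thesis .
  qed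
  then have "j a = hom_of ?w"
    unfolding hom_j_def hom_of_def by (intro restrict_ext) simp
  moreover have "hom_of ?w \<in> carrier H"
    using a unit_at_mult_action by (intro hom_of_in_hom_ring) auto
  moreover have "hom_of ?w (v \<sigma>) = ?w \<sigma>" if "\<sigma> \<in> Mor G" for \<sigma>
    using a that by (subst hom_of_basis) auto
  ultimately show "j a \<in> carrier H" "\<sigma> \<in> Mor G \<Longrightarrow> j a (v \<sigma>) = ?w \<sigma>"
    by auto
qed

lemma ide_action_value [simp]:
  assumes "f \<in> carrier H" "\<sigma> \<in> Mor G"
  shows "ide G (tgt G \<sigma>) \<cdot> f (v \<sigma>) = f (v \<sigma>)"
  using assms by (simp flip: unit_at_mult)

lemma value_mult_unit_at:
  assumes "f \<in> carrier H" "\<sigma> \<in> Mor G"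
  shows "f (v \<sigma>) \<otimes> unit_at (tgt G \<sigma>) = f (v \<sigma>)"
  using assms by (simp add: mult_unit_at)

lemma in_fiber [simp]: "\<tau> \<in> fiber x \<longleftrightarrow> \<tau> \<in> Mor G \<and> tgt G \<tau> = x"
  by (simp add: fiber_def)

lemma minv_ide [simp]: "x \<in> Ob G \<Longrightarrow> minv (ide G x) = ide G x"
  using minv_right[of "ide G x"] ide_left[of "minv (ide G x)"] by simp

lemma minv_cmp_eq_iff:
  assumes "\<sigma> \<in> Mor G" "\<tau> \<in> Mor G" "\<kappa> \<in> Mor G" "tgt G \<tau> = tgt G \<sigma>" "tgt G \<kappa> = src G \<tau>"
  shows "cmp G (minv \<tau>) \<sigma> = \<kappa> \<longleftrightarrow> \<sigma> = cmp G \<tau> \<kappa>"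
  using assms by auto

text \<open>Only the identity in the fiber contributes, and the idempotent it produces is absorbed
  by \<open>f (v \<sigma>)\<close>. Right multiplication by \<open>j a\<close> is thus
  untwisted.\<close>

lemma mult_hom_j_value:
  assumes f: "f \<in> carrier H" and a: "a \<in> carrier A" and \<sigma>: "\<sigma> \<in> Mor G"
  shows "(f \<otimes>\<^bsub>H\<^esub> j a) (v \<sigma>) = f (v \<sigma>) \<otimes> a"
proof -
  have "(f \<otimes>\<^bsub>H\<^esub> j a) (v \<sigma>) =
      (\<Oplus>\<tau>\<in>fiber (tgt G \<sigma>). (\<tau> \<cdot> f (v (cmp G (minv \<tau>) \<sigma>))) \<otimes> j a (v \<tau>))"
    by (rule hom_ring_mult_value[OF f hom_j_closed[OF a] \<sigma>])
  also have "\<dots> = f (v \<sigma>) \<otimes> (ide G (tgt G \<sigma>) \<cdot> a)"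
    using f a \<sigma> by (subst A.add.finprod_delta[where i = "ide G (tgt G \<sigma>)"])
      (auto simp: hom_j_value)
  also have "\<dots> = f (v \<sigma>) \<otimes> a"
    using f a \<sigma> by (simp add: value_mult_unit_at flip: unit_at_mult A.m_assoc)
  finally show ?thesis .
qed

text \<open>\<open>j a\<close> is supported on identities, which forces
  \<open>\<tau> = \<sigma>\<close> in the sum. In contrast to the right action, \<open>a\<close> is
  twisted by \<open>\<sigma>\<close>.\<close>

lemma hom_j_mult_value:
  assumes f: "f \<in> carrier H" and a: "a \<in> carrier A" and \<sigma>: "\<sigma> \<in> Mor G"
  shows "(j a \<otimes>\<^bsub>H\<^esub> f) (v \<sigma>) = (\<sigma> \<cdot> a) \<otimes> f (v \<sigma>)"
proof -
  have "cmp G (minv \<tau>) \<sigma> \<noteq> ide G (src G \<tau>)" if "\<tau> \<in> fiber (tgt G \<sigma>)" "\<tau> \<noteq> \<sigma>" for \<tau>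
    using that \<sigma> by (simp add: minv_cmp_eq_iff)
  then have "(\<Oplus>\<tau>\<in>fiber (tgt G \<sigma>). (\<tau> \<cdot> j a (v (cmp G (minv \<tau>) \<sigma>))) \<otimes> f (v \<tau>)) =
      (\<sigma> \<cdot> a) \<otimes> f (v \<sigma>)"
    using f a \<sigma> by (subst A.add.finprod_delta[where i = \<sigma>]) (auto simp: hom_j_value action_action)
  then show ?thesis
    by (simp only: hom_ring_mult_value[OF hom_j_closed[OF a] f \<sigma>])
qed

section \<open>The generators u and their products with arbitrary elements\<close>

definition u :: "'m \<Rightarrow> ('m \<Rightarrow> 'k) \<Rightarrow> 'a" where
  "u \<sigma> = hom_of (\<lambda>\<rho>. if \<rho> = \<sigma> then unit_at (tgt G \<sigma>) else \<zero>)"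

lemma u_closed [simp]: "\<sigma> \<in> Mor G \<Longrightarrow> u \<sigma> \<in> carrier H"
  unfolding u_def by (rule hom_of_in_hom_ring) (auto simp: unit_at_idem)

lemma u_value: "\<rho> \<in> Mor G \<Longrightarrow> u \<sigma> (v \<rho>) = (if \<rho> = \<sigma> then unit_at (tgt G \<sigma>) else \<zero>)"
  unfolding u_def by (subst hom_of_basis) auto

text \<open>The only possible contribution is at
  \<open>\<tau> = cmp G \<rho> (minv \<sigma>)\<close>, which exists when the sources agree. This
  \<open>\<tau>\<close> carries the idempotent at the target of \<open>\<sigma>\<close> to the one
  at the target of \<open>\<rho>\<close>, which \<open>f\<close> absorbs.\<close>

lemma u_mult_value:
  assumes f: "f \<in> carrier H" and \<sigma>: "\<sigma> \<in> Mor G" and \<rho>: "\<rho> \<in> Mor G"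
  shows "(u \<sigma> \<otimes>\<^bsub>H\<^esub> f) (v \<rho>) = (if src G \<rho> = src G \<sigma> then f (v (cmp G \<rho> (minv \<sigma>))) else \<zero>)"
proof -
  have *: "cmp G (minv \<tau>) \<rho> = \<sigma> \<longleftrightarrow> src G \<rho> = src G \<sigma> \<and> \<tau> = cmp G \<rho> (minv \<sigma>)"
    if "\<tau> \<in> Mor G" "tgt G \<tau> = tgt G \<rho>" for \<tau>
  proof
    assume "cmp G (minv \<tau>) \<rho> = \<sigma>"
    with that \<rho> have "\<rho> = cmp G \<tau> \<sigma>" "tgt G \<sigma> = src G \<tau>" by auto
    with that \<sigma> show "src G \<rho> = src G \<sigma> \<and> \<tau> = cmp G \<rho> (minv \<sigma>)"
      by (simp add: cmp_assoc)
  next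
    assume "src G \<rho> = src G \<sigma> \<and> \<tau> = cmp G \<rho> (minv \<sigma>)"
    with \<sigma> \<rho> show "cmp G (minv \<tau>) \<rho> = \<sigma>"
      using ide_right[OF \<rho>] by (subst minv_cmp_eq_iff) (auto simp: cmp_assoc)
  qed
  have "(u \<sigma> \<otimes>\<^bsub>H\<^esub> f) (v \<rho>) =
      (\<Oplus>\<tau>\<in>fiber (tgt G \<rho>). (\<tau> \<cdot> u \<sigma> (v (cmp G (minv \<tau>) \<rho>))) \<otimes> f (v \<tau>))"
    by (rule hom_ring_mult_value[OF u_closed[OF \<sigma>] f \<rho>])
  also have "\<dots> = (if src G \<rho> = src G \<sigma> then f (v (cmp G \<rho> (minv \<sigma>))) else \<zero>)"
  proof (cases "src G \<rho> = src G \<sigma>")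
    case True
    then show ?thesis
      using f \<sigma> \<rho> unit_at_mult_value[OF f, of "cmp G \<rho> (minv \<sigma>)"]
      by (subst A.add.finprod_delta[where i = "cmp G \<rho> (minv \<sigma>)"])
        (auto simp: u_value * action_unit_at)
  next
    case False
    then show ?thesis
      using f \<sigma> \<rho> by (auto simp: u_value * intro!: A.add.finprod_one_eqI)
  qed
  finally show ?thesis .
qed

lemma mult_u_value:
  assumes f: "f \<in> carrier H" and \<sigma>: "\<sigma> \<in> Mor G" and \<rho>: "\<rho> \<in> Mor G"
  shows "(f \<otimes>\<^bsub>H\<^esub> u \<sigma>) (v \<rho>) = (if tgt G \<rho> = tgt G \<sigma> then \<sigma> \<cdot> f (v (cmp G (minv \<sigma>) \<rho>)) else \<zero>)"
proof -
  have "(\<Oplus>\<tau>\<in>fiber (tgt G \<rho>). (\<tau> \<cdot> f (v (cmp G (minv \<tau>) \<rho>))) \<otimes> u \<sigma> (v \<tau>)) =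
      (if tgt G \<rho> = tgt G \<sigma> then \<sigma> \<cdot> f (v (cmp G (minv \<sigma>) \<rho>)) else \<zero>)"
    using f \<sigma> by (subst A.add.finprod_delta[where i = \<sigma>])
      (auto simp: u_value mult_unit_at action_action)
  then show ?thesis
    by (simp only: hom_ring_mult_value[OF f u_closed[OF \<sigma>] \<rho>])
qed

section \<open>The ring axioms, and j as a ring morphism\<close>

lemma hom_ring_add_value: "\<sigma> \<in> Mor G \<Longrightarrow> (f \<oplus>\<^bsub>H\<^esub> g) (v \<sigma>) = f (v \<sigma>) \<oplus> g (v \<sigma>)"
  by (simp add: hom_ring_def Let_def)

lemma hom_ring_zero_value: "\<zero>\<^bsub>H\<^esub> (v \<sigma>) = \<zero>"
  by (simp add: hom_ring_def Let_def)

lemma hom_ring_one: "\<one>\<^bsub>H\<^esub> = j \<one>"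
  by (simp add: hom_ring_def Let_def)

text \<open>Sum and zero of the ring are defined on all of \<open>Gk\<close>. Recognising them as
  some \<open>hom_of w\<close> reduces linearity and the twisted condition to the basis values
  \<open>w\<close>.\<close>

lemma hom_ring_pointwiseI:
  assumes "F \<in> extensional (carrier Gk)"
    and "\<And>h. h \<in> carrier Gk \<Longrightarrow> F h = (\<Oplus>\<sigma>\<in>Mor G. h \<sigma> \<odot> w \<sigma>)"
    and "\<And>\<sigma>. \<sigma> \<in> Mor G \<Longrightarrow> w \<sigma> \<in> carrier A"
    and "\<And>\<sigma>. \<sigma> \<in> Mor G \<Longrightarrow> unit_at (tgt G \<sigma>) \<otimes> w \<sigma> = w \<sigma>"
  shows "F \<in> carrier H"
proof -
  have "F = hom_of w"
    using assms(1,2) by (intro extensionalityI[where A = "carrier Gk"]) (auto simp: hom_of_def)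
  then show ?thesis
    using assms(3,4) by (auto intro: hom_of_in_hom_ring)
qed

lemma hom_ring_add_closed:
  assumes f: "f \<in> carrier H" and g: "g \<in> carrier H"
  shows "f \<oplus>\<^bsub>H\<^esub> g \<in> carrier H"
proof (rule hom_ring_pointwiseI[where w = "\<lambda>\<sigma>. f (v \<sigma>) \<oplus> g (v \<sigma>)"])
  fix h assume h: "h \<in> carrier Gk"
  have "(f \<oplus>\<^bsub>H\<^esub> g) h = (\<Oplus>\<sigma>\<in>Mor G. h \<sigma> \<odot> f (v \<sigma>)) \<oplus> (\<Oplus>\<sigma>\<in>Mor G. h \<sigma> \<odot> g (v \<sigma>))"
    using h linear_expand[OF hom_ring_linear[OF f] h] linear_expand[OF hom_ring_linear[OF g] h]
    by (simp add: hom_ring_def Let_def)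
  also have "\<dots> = (\<Oplus>\<sigma>\<in>Mor G. h \<sigma> \<odot> f (v \<sigma>) \<oplus> h \<sigma> \<odot> g (v \<sigma>))"
    using h f g by (intro A.finsum_addf[symmetric]) (auto simp: Gk_closed)
  also have "\<dots> = (\<Oplus>\<sigma>\<in>Mor G. h \<sigma> \<odot> (f (v \<sigma>) \<oplus> g (v \<sigma>)))"
    using h f g by (intro A.finsum_cong') (auto simp: Gk_closed smult_r_distr)
  finally show "(f \<oplus>\<^bsub>H\<^esub> g) h = (\<Oplus>\<sigma>\<in>Mor G. h \<sigma> \<odot> (f (v \<sigma>) \<oplus> g (v \<sigma>)))" .
qed (use f g in \<open>auto simp: A.r_distr, simp add: hom_ring_def Let_def\<close>)

lemma hom_ring_zero_closed: "\<zero>\<^bsub>H\<^esub> \<in> carrier H"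
proof (rule hom_ring_pointwiseI[where w = "\<lambda>\<sigma>. \<zero>"])
  fix h assume h: "h \<in> carrier Gk"
  then have "(\<Oplus>\<sigma>\<in>Mor G. h \<sigma> \<odot> \<zero>) = \<zero>"
    by (intro A.add.finprod_one_eqI) (auto simp: Gk_closed)
  then show "\<zero>\<^bsub>H\<^esub> h = (\<Oplus>\<sigma>\<in>Mor G. h \<sigma> \<odot> \<zero>)"
    using h by (simp add: hom_ring_def Let_def)
qed (auto, simp add: hom_ring_def Let_def)

lemma finsum_fiber_reindex:
  assumes "\<tau> \<in> Mor G" and "\<And>\<gamma>. \<gamma> \<in> fiber (tgt G \<tau>) \<Longrightarrow> f \<gamma> \<in> carrier A"
  shows "(\<Oplus>\<alpha>\<in>fiber (src G \<tau>). f (cmp G \<tau> \<alpha>)) = (\<Oplus>\<gamma>\<in>fiber (tgt G \<tau>). f \<gamma>)"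
proof (rule A.add.finprod_bij_betw)
  show "bij_betw (cmp G \<tau>) (fiber (src G \<tau>)) (fiber (tgt G \<tau>))"
    by (rule bij_betw_byWitness[where f' = "cmp G (minv \<tau>)"]) (use assms(1) in auto)
qed (use assms(2) in auto)

text \<open>Both bracketings are sums of the same terms \<open>s \<tau> \<gamma>\<close> over pairs
  from one fiber, taken in opposite orders.\<close>

lemma hom_ring_mult_assoc:
  assumes f: "f \<in> carrier H" and g: "g \<in> carrier H" and h: "h \<in> carrier H"
  shows "(f \<otimes>\<^bsub>H\<^esub> g) \<otimes>\<^bsub>H\<^esub> h = f \<otimes>\<^bsub>H\<^esub> (g \<otimes>\<^bsub>H\<^esub> h)"
proof (rule hom_ring_ext)
  fix \<sigma> assume \<sigma>: "\<sigma> \<in> Mor G"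
  let ?F = "fiber (tgt G \<sigma>)"
  \<comment> \<open>Here \<open>\<gamma>\<close> stands for the composite of \<open>\<tau>\<close>
    with the inner summation variable \<open>\<alpha>\<close> of the left bracketing.\<close>
  define s where "s \<tau> \<gamma> =
    (\<gamma> \<cdot> f (v (cmp G (minv \<gamma>) \<sigma>))) \<otimes> ((\<tau> \<cdot> g (v (cmp G (minv \<tau>) \<gamma>))) \<otimes> h (v \<tau>))" for \<tau> \<gamma>
  have s_closed: "s \<tau> \<gamma> \<in> carrier A" for \<tau> \<gamma>
    using f g h by (simp add: s_def)
  have "(\<tau> \<cdot> (f \<otimes>\<^bsub>H\<^esub> g) (v (cmp G (minv \<tau>) \<sigma>))) \<otimes> h (v \<tau>) = (\<Oplus>\<gamma>\<in>?F. s \<tau> \<gamma>)"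
    if \<tau>: "\<tau> \<in> ?F" for \<tau>
  proof -
    have "(\<tau> \<cdot> ((\<alpha> \<cdot> f (v (cmp G (minv \<alpha>) (cmp G (minv \<tau>) \<sigma>)))) \<otimes> g (v \<alpha>))) \<otimes> h (v \<tau>) = s \<tau> (cmp G \<tau> \<alpha>)"
      if \<alpha>: "\<alpha> \<in> fiber (src G \<tau>)" for \<alpha>
    proof -
      \<comment> \<open>The inverse of a composite enters only through its effect on
        \<open>\<sigma>\<close>, so cancellation suffices.\<close>
      have "cmp G (minv \<alpha>) (cmp G (minv \<tau>) \<sigma>) = cmp G (minv (cmp G \<tau> \<alpha>)) \<sigma>"
        using \<alpha> \<tau> \<sigma> by (subst eq_commute, subst minv_cmp_eq_iff) (auto simp: cmp_assoc)
      then show ?thesis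
        using \<alpha> \<tau> \<sigma> f g h by (simp add: s_def act_product action_action A.m_assoc)
    qed
    moreover have "(\<tau> \<cdot> (f \<otimes>\<^bsub>H\<^esub> g) (v (cmp G (minv \<tau>) \<sigma>))) \<otimes> h (v \<tau>) =
      (\<Oplus>\<alpha>\<in>fiber (src G \<tau>). (\<tau> \<cdot> ((\<alpha> \<cdot> f (v (cmp G (minv \<alpha>) (cmp G (minv \<tau>) \<sigma>)))) \<otimes> g (v \<alpha>))) \<otimes> h (v \<tau>))"
      using \<tau> \<sigma> f g h
      by (subst hom_ring_mult_value[OF f g]) (auto simp: action_finsum A.finsum_ldistr)
    ultimately have "(\<tau> \<cdot> (f \<otimes>\<^bsub>H\<^esub> g) (v (cmp G (minv \<tau>) \<sigma>))) \<otimes> h (v \<tau>) =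
      (\<Oplus>\<alpha>\<in>fiber (src G \<tau>). s \<tau> (cmp G \<tau> \<alpha>))"
      using s_closed by (auto intro!: A.finsum_cong')
    then show ?thesis
      using \<tau> s_closed finsum_fiber_reindex[of \<tau> "s \<tau>"] by simp
  qed
  then have "((f \<otimes>\<^bsub>H\<^esub> g) \<otimes>\<^bsub>H\<^esub> h) (v \<sigma>) = (\<Oplus>\<tau>\<in>?F. \<Oplus>\<gamma>\<in>?F. s \<tau> \<gamma>)"
    using \<sigma> s_closed
    by (subst hom_ring_mult_value[OF hom_ring_mult_closed[OF f g] h]) (auto intro!: A.finsum_cong')
  also have "\<dots> = (\<Oplus>\<gamma>\<in>?F. \<Oplus>\<tau>\<in>?F. s \<tau> \<gamma>)"
    using s_closed by (intro A.add.finprod_swap) auto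
  also have "\<dots> = (\<Oplus>\<gamma>\<in>?F. (\<gamma> \<cdot> f (v (cmp G (minv \<gamma>) \<sigma>))) \<otimes> (g \<otimes>\<^bsub>H\<^esub> h) (v \<gamma>))"
    using f g h hom_ring_mult_closed[OF g h] by (intro A.finsum_cong')
      (auto simp: s_def hom_ring_mult_value[OF g h] A.finsum_rdistr)
  also have "\<dots> = (f \<otimes>\<^bsub>H\<^esub> (g \<otimes>\<^bsub>H\<^esub> h)) (v \<sigma>)"
    using \<sigma> by (simp add: hom_ring_mult_value[OF f hom_ring_mult_closed[OF g h]])
  finally show "((f \<otimes>\<^bsub>H\<^esub> g) \<otimes>\<^bsub>H\<^esub> h) (v \<sigma>) = (f \<otimes>\<^bsub>H\<^esub> (g \<otimes>\<^bsub>H\<^esub> h)) (v \<sigma>)" .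
qed (use f g h in \<open>auto intro: hom_ring_mult_closed\<close>)

lemma ring_hom_ring: "ring H"
proof (rule ringI)
  show "abelian_group H"
  proof (rule abelian_groupI)
    fix f assume f: "f \<in> carrier H"
    let ?n = "hom_of (\<lambda>\<sigma>. \<ominus> f (v \<sigma>))"
    have n: "?n \<in> carrier H"
      using f by (intro hom_of_in_hom_ring) (auto simp: A.r_minus)
    moreover have "?n \<oplus>\<^bsub>H\<^esub> f = \<zero>\<^bsub>H\<^esub>"
      using f n by (intro hom_ring_ext)
        (auto simp: hom_ring_add_closed hom_ring_zero_closed hom_ring_add_value hom_ring_zero_value
          hom_of_basis A.l_neg)
    ultimately show "\<exists>g\<in>carrier H. g \<oplus>\<^bsub>H\<^esub> f = \<zero>\<^bsub>H\<^esub>" by blast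
    show "\<zero>\<^bsub>H\<^esub> \<oplus>\<^bsub>H\<^esub> f = f"
      using f by (intro hom_ring_ext)
        (auto simp: hom_ring_add_closed hom_ring_zero_closed hom_ring_add_value hom_ring_zero_value)
  next
    fix f g assume "f \<in> carrier H" "g \<in> carrier H"
    then show "f \<oplus>\<^bsub>H\<^esub> g = g \<oplus>\<^bsub>H\<^esub> f"
      by (intro hom_ring_ext) (auto simp: hom_ring_add_closed hom_ring_add_value A.a_comm)
  next
    fix f g h assume "f \<in> carrier H" "g \<in> carrier H" "h \<in> carrier H"
    then show "f \<oplus>\<^bsub>H\<^esub> g \<oplus>\<^bsub>H\<^esub> h = f \<oplus>\<^bsub>H\<^esub> (g \<oplus>\<^bsub>H\<^esub> h)"
      by (intro hom_ring_ext) (auto simp: hom_ring_add_closed hom_ring_add_value A.a_assoc)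
  qed (auto simp: hom_ring_add_closed hom_ring_zero_closed)
next
  show "Group.monoid H"
  proof (rule monoidI)
    show "\<one>\<^bsub>H\<^esub> \<in> carrier H" by (simp add: hom_ring_one hom_j_closed)
    fix f assume f: "f \<in> carrier H"
    show "\<one>\<^bsub>H\<^esub> \<otimes>\<^bsub>H\<^esub> f = f" "f \<otimes>\<^bsub>H\<^esub> \<one>\<^bsub>H\<^esub> = f"
      using f by (auto intro!: hom_ring_ext
          simp: hom_ring_one hom_j_closed hom_ring_mult_closed hom_j_mult_value mult_hom_j_value action_one)
  qed (auto simp: hom_ring_mult_closed hom_ring_mult_assoc)
next
  fix f g h assume fgh: "f \<in> carrier H" "g \<in> carrier H" "h \<in> carrier H"
  note closed = hom_ring_mult_closed hom_ring_add_closed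
  show "(f \<oplus>\<^bsub>H\<^esub> g) \<otimes>\<^bsub>H\<^esub> h = f \<otimes>\<^bsub>H\<^esub> h \<oplus>\<^bsub>H\<^esub> g \<otimes>\<^bsub>H\<^esub> h"
  proof (rule hom_ring_ext)
    fix \<sigma> assume \<sigma>: "\<sigma> \<in> Mor G"
    have "((f \<oplus>\<^bsub>H\<^esub> g) \<otimes>\<^bsub>H\<^esub> h) (v \<sigma>) = (\<Oplus>\<tau>\<in>fiber (tgt G \<sigma>).
        (\<tau> \<cdot> f (v (cmp G (minv \<tau>) \<sigma>))) \<otimes> h (v \<tau>) \<oplus> (\<tau> \<cdot> g (v (cmp G (minv \<tau>) \<sigma>))) \<otimes> h (v \<tau>))"
      using fgh \<sigma> by (subst hom_ring_mult_value)
        (auto simp: closed hom_ring_add_value action_add A.l_distr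
          simp del: A.finsum_addf intro!: A.finsum_cong')
    also have "\<dots> = (f \<otimes>\<^bsub>H\<^esub> h \<oplus>\<^bsub>H\<^esub> g \<otimes>\<^bsub>H\<^esub> h) (v \<sigma>)"
      using fgh \<sigma> by (subst A.finsum_addf) (auto simp: hom_ring_add_value hom_ring_mult_value)
    finally show "((f \<oplus>\<^bsub>H\<^esub> g) \<otimes>\<^bsub>H\<^esub> h) (v \<sigma>) = (f \<otimes>\<^bsub>H\<^esub> h \<oplus>\<^bsub>H\<^esub> g \<otimes>\<^bsub>H\<^esub> h) (v \<sigma>)" .
  qed (use fgh in \<open>auto simp: closed\<close>)
  show "h \<otimes>\<^bsub>H\<^esub> (f \<oplus>\<^bsub>H\<^esub> g) = h \<otimes>\<^bsub>H\<^esub> f \<oplus>\<^bsub>H\<^esub> h \<otimes>\<^bsub>H\<^esub> g"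
  proof (rule hom_ring_ext)
    fix \<sigma> assume \<sigma>: "\<sigma> \<in> Mor G"
    have "(h \<otimes>\<^bsub>H\<^esub> (f \<oplus>\<^bsub>H\<^esub> g)) (v \<sigma>) = (\<Oplus>\<tau>\<in>fiber (tgt G \<sigma>).
        (\<tau> \<cdot> h (v (cmp G (minv \<tau>) \<sigma>))) \<otimes> f (v \<tau>) \<oplus> (\<tau> \<cdot> h (v (cmp G (minv \<tau>) \<sigma>))) \<otimes> g (v \<tau>))"
      using fgh \<sigma> by (subst hom_ring_mult_value)
        (auto simp: closed hom_ring_add_value A.r_distr
          simp del: A.finsum_addf intro!: A.finsum_cong')
    also have "\<dots> = (h \<otimes>\<^bsub>H\<^esub> f \<oplus>\<^bsub>H\<^esub> h \<otimes>\<^bsub>H\<^esub> g) (v \<sigma>)"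
      using fgh \<sigma> by (subst A.finsum_addf) (auto simp: hom_ring_add_value hom_ring_mult_value)
    finally show "(h \<otimes>\<^bsub>H\<^esub> (f \<oplus>\<^bsub>H\<^esub> g)) (v \<sigma>) = (h \<otimes>\<^bsub>H\<^esub> f \<oplus>\<^bsub>H\<^esub> h \<otimes>\<^bsub>H\<^esub> g) (v \<sigma>)" .
  qed (use fgh in \<open>auto simp: closed\<close>)
qed

lemma hom_j_ring_hom: "j \<in> ring_hom A H"
proof (rule ring_hom_memI)
  fix a b assume ab: "a \<in> carrier A" "b \<in> carrier A"
  show "j (a \<otimes> b) = j a \<otimes>\<^bsub>H\<^esub> j b"
  proof (rule hom_ring_ext)
    fix \<sigma> assume "\<sigma> \<in> Mor G"
    with ab show "j (a \<otimes> b) (v \<sigma>) = (j a \<otimes>\<^bsub>H\<^esub> j b) (v \<sigma>)"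
      \<comment> \<open>At an identity both sides agree by multiplicativity of the action; at any
        other morphism both vanish.\<close>
      by (simp add: hom_j_mult_value hom_j_closed) (simp add: hom_j_value act_product)
  qed (use ab in \<open>auto intro!: hom_j_closed hom_ring_mult_closed\<close>)
  show "j (a \<oplus> b) = j a \<oplus>\<^bsub>H\<^esub> j b"
    using ab by (intro hom_ring_ext)
      (auto simp: hom_j_closed hom_ring_add_closed hom_ring_add_value hom_j_value action_add)
qed (simp_all add: hom_j_closed hom_ring_one)

sublocale hom_extension: ring_extension A H j
  using A.ring_axioms ring_hom_ring hom_j_ring_hom
  by (intro ring_extension.intro ring_extension_axioms.intro)

lemma finsum_value:
  assumes "finite S" and "F \<in> S \<rightarrow> carrier H" and "\<sigma> \<in> Mor G"
  shows "(\<Oplus>\<^bsub>H\<^esub>s\<in>S. F s) (v \<sigma>) = (\<Oplus>s\<in>S. F s (v \<sigma>))"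
  using assms(1,2)
proof (induction S rule: finite_induct)
  case empty
  then show ?case by (simp add: hom_ring_zero_value)
next
  case (insert s S)
  then have "(\<lambda>s. F s (v \<sigma>)) \<in> S \<rightarrow> carrier A" "F s (v \<sigma>) \<in> carrier A"
    by (auto simp: Pi_iff)
  with insert assms(3) show ?case
    by (simp add: hom_ring_add_value)
qed

section \<open>The Frobenius system\<close>

definition trace :: "(('m \<Rightarrow> 'k) \<Rightarrow> 'a) \<Rightarrow> 'a" where
  "trace f = (\<Oplus>x\<in>Ob G. f (v (ide G x)))"

lemma trace_closed [simp]: "f \<in> carrier H \<Longrightarrow> trace f \<in> carrier A"
  unfolding trace_def by (auto intro!: A.finsum_closed)

lemma trace_bimodule_map: "trace \<in> bimodule_maps A H j"
proof -
  have "trace (f \<oplus>\<^bsub>H\<^esub> g) = trace f \<oplus> trace g" if "f \<in> carrier H" "g \<in> carrier H" for f g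
    unfolding trace_def using that
    by (subst A.finsum_addf[symmetric]) (auto simp: hom_ring_add_value simp del: A.finsum_addf intro!: A.finsum_cong')
  moreover have "trace (f \<otimes>\<^bsub>H\<^esub> j a) = trace f \<otimes> a" if "f \<in> carrier H" "a \<in> carrier A" for f a
    unfolding trace_def using that
    by (subst A.finsum_ldistr) (auto simp: finite_Ob mult_hom_j_value intro!: A.finsum_cong')
  moreover have "trace (j a \<otimes>\<^bsub>H\<^esub> f) = a \<otimes> trace f" if fa: "f \<in> carrier H" "a \<in> carrier A" for f a
  proof -
    \<comment> \<open>Left linearity survives the twist because only identities occur:
      \<open>ide G x \<cdot> a\<close> is \<open>a\<close> times the idempotent at \<open>x\<close>,
      and \<open>f (v (ide G x))\<close> absorbs that idempotent.\<close>
    have "(ide G x \<cdot> a) \<otimes> f (v (ide G x)) = a \<otimes> f (v (ide G x))" if "x \<in> Ob G" for x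
      using fa that unit_at_mult_value[of f "ide G x"]
      by (simp add: A.m_assoc flip: mult_unit_at)
    then show ?thesis
      unfolding trace_def using fa
      by (subst A.finsum_rdistr) (auto simp: finite_Ob hom_j_mult_value intro!: A.finsum_cong')
  qed
  ultimately show ?thesis
    by (simp add: bimodule_maps_def)
qed

lemma trace_u:
  assumes "\<sigma> \<in> Mor G"
  shows "trace (u \<sigma>) = (if \<sigma> = ide G (tgt G \<sigma>) then unit_at (tgt G \<sigma>) else \<zero>)"
  unfolding trace_def using assms
  by (subst A.add.finprod_delta[where i = "tgt G \<sigma>"]) (auto simp: finite_Ob u_value)

definition left_coeff :: "(('m \<Rightarrow> 'k) \<Rightarrow> 'a) \<Rightarrow> 'm \<Rightarrow> 'm \<Rightarrow> 'a" where
  "left_coeff f \<rho> \<sigma> = (if tgt G \<rho> = tgt G \<sigma> then \<sigma> \<cdot> f (v (cmp G (minv \<sigma>) \<rho>)) else \<zero>)"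

lemma left_coeff_closed [simp]: "f \<in> carrier H \<Longrightarrow> left_coeff f \<rho> \<sigma> \<in> carrier A"
  by (simp add: left_coeff_def)

text \<open>Right multiplication by \<open>j\<close> is untwisted, so the coefficient of an element
  at \<open>u \<rho>\<close> is just its value at \<open>v \<rho>\<close>.\<close>

lemma mult_u_expand:
  assumes f: "f \<in> carrier H" and \<sigma>: "\<sigma> \<in> Mor G"
  shows "f \<otimes>\<^bsub>H\<^esub> u \<sigma> = (\<Oplus>\<^bsub>H\<^esub>\<rho>\<in>Mor G. u \<rho> \<otimes>\<^bsub>H\<^esub> j (left_coeff f \<rho> \<sigma>))"
proof (rule hom_ring_ext)
  fix \<tau> assume \<tau>: "\<tau> \<in> Mor G"
  have "(\<Oplus>\<^bsub>H\<^esub>\<rho>\<in>Mor G. u \<rho> \<otimes>\<^bsub>H\<^esub> j (left_coeff f \<rho> \<sigma>)) (v \<tau>) =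
      (\<Oplus>\<rho>\<in>Mor G. u \<rho> (v \<tau>) \<otimes> left_coeff f \<rho> \<sigma>)"
    using f \<tau> by (subst finsum_value)
      (auto simp: finite_Mor hom_j_closed mult_hom_j_value intro!: A.finsum_cong')
  also have "\<dots> = unit_at (tgt G \<tau>) \<otimes> left_coeff f \<tau> \<sigma>"
    using f \<tau> by (subst A.add.finprod_delta[where i = \<tau>]) (auto simp: finite_Mor u_value)
  also have "\<dots> = (f \<otimes>\<^bsub>H\<^esub> u \<sigma>) (v \<tau>)"
    using f \<sigma> \<tau> unit_at_mult_action[OF \<sigma>] by (simp add: mult_u_value left_coeff_def)
  finally show "(f \<otimes>\<^bsub>H\<^esub> u \<sigma>) (v \<tau>) = (\<Oplus>\<^bsub>H\<^esub>\<rho>\<in>Mor G. u \<rho> \<otimes>\<^bsub>H\<^esub> j (left_coeff f \<rho> \<sigma>)) (v \<tau>)"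
    by simp
qed (use assms in \<open>auto simp: hom_j_closed\<close>)

lemma finsum_hom_j_u_value:
  assumes c: "\<And>\<sigma>. \<sigma> \<in> Mor G \<Longrightarrow> c \<sigma> \<in> carrier A" and \<tau>: "\<tau> \<in> Mor G"
  shows "(\<Oplus>\<^bsub>H\<^esub>\<sigma>\<in>Mor G. j (c \<sigma>) \<otimes>\<^bsub>H\<^esub> u (minv \<sigma>)) (v \<tau>) = \<tau> \<cdot> c (minv \<tau>)"
proof -
  have "(\<Oplus>\<^bsub>H\<^esub>\<sigma>\<in>Mor G. j (c \<sigma>) \<otimes>\<^bsub>H\<^esub> u (minv \<sigma>)) (v \<tau>) =
      (\<Oplus>\<sigma>\<in>Mor G. (\<tau> \<cdot> c \<sigma>) \<otimes> u (minv \<sigma>) (v \<tau>))"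
    using c \<tau> by (subst finsum_value)
      (auto simp: finite_Mor hom_j_closed hom_j_mult_value intro!: A.finsum_cong')
  also have "\<dots> = (\<tau> \<cdot> c (minv \<tau>)) \<otimes> unit_at (tgt G \<tau>)"
    using c \<tau> by (subst A.add.finprod_delta[where i = "minv \<tau>"]) (auto simp: finite_Mor u_value)
  also have "\<dots> = \<tau> \<cdot> c (minv \<tau>)"
    using c \<tau> by (simp add: mult_unit_at action_action)
  finally show ?thesis .
qed

text \<open>The twist by \<open>\<tau>\<close> cancels the action of \<open>minv \<tau>\<close>
  inside the coefficient at \<open>\<sigma> = minv \<tau>\<close>, leaving
  \<open>f (v (cmp G \<tau> \<rho>))\<close> as in \<open>u_mult_value\<close>. Both sides vanish
  when \<open>\<tau>\<close> and \<open>\<rho>\<close> are not composable.\<close>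

lemma u_mult_expand:
  assumes f: "f \<in> carrier H" and \<rho>: "\<rho> \<in> Mor G"
  shows "u (minv \<rho>) \<otimes>\<^bsub>H\<^esub> f = (\<Oplus>\<^bsub>H\<^esub>\<sigma>\<in>Mor G. j (left_coeff f \<rho> \<sigma>) \<otimes>\<^bsub>H\<^esub> u (minv \<sigma>))"
proof (rule hom_ring_ext)
  fix \<tau> assume \<tau>: "\<tau> \<in> Mor G"
  have "ide G (tgt G \<tau>) \<cdot> f (v (cmp G \<tau> \<rho>)) = f (v (cmp G \<tau> \<rho>))" if "tgt G \<rho> = src G \<tau>"
    using f \<rho> \<tau> that ide_action_value[of f "cmp G \<tau> \<rho>"] by simp
  then show "(u (minv \<rho>) \<otimes>\<^bsub>H\<^esub> f) (v \<tau>) =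
      (\<Oplus>\<^bsub>H\<^esub>\<sigma>\<in>Mor G. j (left_coeff f \<rho> \<sigma>) \<otimes>\<^bsub>H\<^esub> u (minv \<sigma>)) (v \<tau>)"
    using f \<rho> \<tau> by (auto simp: finsum_hom_j_u_value u_mult_value left_coeff_def action_action)
qed (use assms in \<open>auto simp: hom_j_closed\<close>)

lemma sum_trace_left: "(\<Oplus>\<^bsub>H\<^esub>\<sigma>\<in>Mor G. j (trace (u \<sigma>)) \<otimes>\<^bsub>H\<^esub> u (minv \<sigma>)) = \<one>\<^bsub>H\<^esub>"
proof (rule hom_ring_ext)
  fix \<tau> assume \<tau>: "\<tau> \<in> Mor G"
  \<comment> \<open>The trace of \<open>u (minv \<tau>)\<close> tests \<open>minv \<tau>\<close>
    against the identity at its target, the source of \<open>\<tau>\<close>; this has to match the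
    support of \<open>j \<one>\<close>.\<close>
  have "minv \<tau> = ide G (src G \<tau>) \<longleftrightarrow> \<tau> = ide G (tgt G \<tau>)"
    using \<tau> by (metis minv_ide minv_minv src_closed src_ide tgt_closed tgt_ide)
  then show "(\<Oplus>\<^bsub>H\<^esub>\<sigma>\<in>Mor G. j (trace (u \<sigma>)) \<otimes>\<^bsub>H\<^esub> u (minv \<sigma>)) (v \<tau>) = \<one>\<^bsub>H\<^esub> (v \<tau>)"
    using \<tau> by (simp add: finsum_hom_j_u_value trace_u hom_ring_one hom_j_value action_unit_at action_one)
qed (auto simp: hom_j_closed)

lemma sum_trace_right: "(\<Oplus>\<^bsub>H\<^esub>\<sigma>\<in>Mor G. u \<sigma> \<otimes>\<^bsub>H\<^esub> j (trace (u (minv \<sigma>)))) = \<one>\<^bsub>H\<^esub>"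
proof (rule hom_ring_ext)
  fix \<tau> assume \<tau>: "\<tau> \<in> Mor G"
  have eq: "minv \<tau> = ide G (src G \<tau>) \<longleftrightarrow> \<tau> = ide G (tgt G \<tau>)"
    using \<tau> by (metis minv_ide minv_minv src_closed src_ide tgt_closed tgt_ide)
  \<comment> \<open>The trace yields the idempotent at the source of \<open>\<tau>\<close>, the unit
    the one at its target.\<close>
  have src: "src G \<tau> = tgt G \<tau>" if "\<tau> = ide G (tgt G \<tau>)"
    using \<tau> that by (metis src_ide tgt_closed)
  have "(\<Oplus>\<^bsub>H\<^esub>\<sigma>\<in>Mor G. u \<sigma> \<otimes>\<^bsub>H\<^esub> j (trace (u (minv \<sigma>)))) (v \<tau>) =
      (\<Oplus>\<sigma>\<in>Mor G. u \<sigma> (v \<tau>) \<otimes> trace (u (minv \<sigma>)))"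
    using \<tau> by (subst finsum_value)
      (auto simp: finite_Mor hom_j_closed mult_hom_j_value intro!: A.finsum_cong')
  also have "\<dots> = unit_at (tgt G \<tau>) \<otimes> trace (u (minv \<tau>))"
    using \<tau> by (subst A.add.finprod_delta[where i = \<tau>]) (auto simp: finite_Mor u_value)
  also have "\<dots> = \<one>\<^bsub>H\<^esub> (v \<tau>)"
    using \<tau> eq src by (simp add: trace_u hom_ring_one hom_j_value unit_at_idem action_one)
  finally show "(\<Oplus>\<^bsub>H\<^esub>\<sigma>\<in>Mor G. u \<sigma> \<otimes>\<^bsub>H\<^esub> j (trace (u (minv \<sigma>)))) (v \<tau>) = \<one>\<^bsub>H\<^esub> (v \<tau>)" .
qed (auto simp: hom_j_closed)

lemma frobenius_morphism_hom_j: "frobenius_morphism A H j"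
  by (rule hom_extension.frobenius_morphismI
      [where S = "Mor G" and p = u and q = "\<lambda>\<sigma>. u (minv \<sigma>)" and \<nu> = trace and c = left_coeff])
    (auto simp: finite_Mor trace_bimodule_map mult_u_expand u_mult_expand sum_trace_left sum_trace_right)

end

theorem proposition4p3:
  fixes K :: "('k, 'x) ring_scheme"
    and G :: "('o, 'm, 'z) groupoid_scheme"
    and A :: "('k, 'a, 'y) module_scheme"
    and act :: "('m \<Rightarrow> 'k) \<Rightarrow> 'a \<Rightarrow> 'a"
  assumes "cring K"
    and "groupoid G" and "finite (Mor G)"
    and "left_groupoid_module_algebra K G A act"
  shows "frobenius_morphism A (hom_ring K G A act) (hom_j K G A act)"
proof -
  interpret left_groupoid_module_algebra K G A act by fact
  interpret finite_groupoid_module_algebra K G A act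
    using assms ring_axioms
    by (intro finite_groupoid_module_algebra.intro finite_groupoid_module_algebra_axioms.intro)
  show ?thesis by (rule frobenius_morphism_hom_j)
qed

end
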